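(* Let $m,n\ge 2$, let $P_{m-1,n-1}=\Delta_{m-1}\times\Delta_{n-1}\subset\mathbb{R}^{m+n}$, and let $c\in\mathbb{R}^{m+n}$ be generic (i.e. edge-generic for $P_{m-1,n-1}$). Then the max-slope pivot rule polytope $\Pi(P_{m-1,n-1},c)$ is combinatorially isomorphic to the $(m,n)$-constrainahedron $C(m,n)$; that is, the poset of nonempty faces of $\Pi(P_{m-1,n-1},c)$ ordered by inclusion is isomorphic to $C(m,n)$.
   Context: $\Delta_{k-1}=\mathrm{conv}(e_1,\dots,e_k)\subset\mathbb{R}^k$ is the standard simplex. Let $P\subset\mathbb{R}^d$ be a convex polytope with vertex set $V(P)$ and edge set $E(P)$. A vector $c\in\mathbb{R}^d$ is edge-generic for $P$ if $\langle c,u\rangle\ne\langle c,v\rangle$ for all edges $uv\in E(P)$. Then $c$ has a unique maximizer $v_{\mathrm{opt}}\in V(P)$ over $P$. A $c$-arborescence of $(P,c)$ is a map $\mathcal{A}:V(P)\setminus\{v_{\mathrm{opt}}\}\to V(P)$ such that for every $v\neq v_{\mathrm{opt}}$, $\mathcal{A}(v)$ is adjacent to $v$ and $\langle c,\mathcal{A}(v)\rangle>\langle c,v\rangle$. Put $\psi(\mathcal{A})=\sum_{v\ne v_{\mathrm{opt}}}\frac{\mathcal{A}(v)-v}{\langle c,\mathcal{A}(v)-v\rangle}$. The max-slope pivot rule polytope of $(P,c)$ is $\Pi(P,c)=\mathrm{conv}\{\psi(\mathcal{A}):\mathcal{A}\text{ a }c\text{-arborescence of }(P,c)\}$. Let $\mathcal{L}=\{L'_1,\dots,L'_{m-1},L''_1,\dots,L''_{n-1}\}$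 be a set of $m+n-2$ distinct symbols. A preorder on $\mathcal{L}$ is a reflexive transitive relation $\preceq$; write $x\prec y$ if $x\preceq y$ and not $y\preceq x$, and call $x,y$ comparable if $x\preceq y$ or $y\preceq x$. A preorder $\preceq$ on $\mathcal{L}$ is good rectangular if: (1) (orthogonal comparability) $L'_r$ and $L''_i$ are comparable for all $r,i$; and (2) for all $o\ne q$, $L'_o$ and $L'_q$ are comparable if and only if (orthogonal link) there is some $p$ with $L'_o\preceq L''_p\preceq L'_q$ or $L'_q\preceq L''_p\preceq L'_o$, or (no gaps) there is no $p$ with $\min(o,q)<p<\max(o,q)$, $L'_o\prec L'_p$ and $L'_q\prec L'_p$; and the same condition holds with the roles of $L'$ and $L''$ exchanged. $C(m,n)$ is the set of good rectangular preorders on $\mathcal{L}$ partially ordered by refinement: $\preceq_1$ lies below $\preceq_2$ if $x\preceq_1 y$ implies $x\preceq_2 y$ for all $x,y\in\mathcal{L}$. *)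

theory Defs
  imports "HOL-Analysis.Analysis"
begin

definition standard_simplex :: "(real ^ 'k) set" where
  "standard_simplex = convex hull (range (\<lambda>i. axis i 1))"

definition vertices :: "'a::euclidean_space set \<Rightarrow> 'a set" where
  "vertices P = {v. v extreme_point_of P}"

definition adjacent :: "'a::euclidean_space set \<Rightarrow> 'a \<Rightarrow> 'a \<Rightarrow> bool" where
  "adjacent P u v \<longleftrightarrow> u \<in> vertices P \<and> v \<in> vertices P \<and> closed_segment u v edge_of P"

definition edge_generic :: "'a::euclidean_space set \<Rightarrow> 'a \<Rightarrow> bool" where
  "edge_generic P c \<longleftrightarrow> (\<forall>u v. adjacent P u v \<longrightarrow> c \<bullet> u \<noteq> c \<bullet> v)"

text \<open>The description is meaningful when \<open>P\<close> is a nonempty polytope and \<open>c\<close> is edge-generic for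
  \<open>P\<close>; in that case the maximizing vertex is unique.\<close>

definition opt_vertex :: "'a::euclidean_space set \<Rightarrow> 'a \<Rightarrow> 'a" where
  "opt_vertex P c = (THE v. v \<in> vertices P \<and> (\<forall>x\<in>P. c \<bullet> x \<le> c \<bullet> v))"

text \<open>Arborescences are extensional functions, so that they correspond exactly to maps with domain
  \<open>vertices P - {opt_vertex P c}\<close>.\<close>

definition arborescences :: "'a::euclidean_space set \<Rightarrow> 'a \<Rightarrow> ('a \<Rightarrow> 'a) set" where
  "arborescences P c =
     {A \<in> (vertices P - {opt_vertex P c}) \<rightarrow>\<^sub>E vertices P.
        \<forall>v \<in> vertices P - {opt_vertex P c}. adjacent P v (A v) \<and> c \<bullet> A v > c \<bullet> v}"

definition arborescence_point :: "'a::euclidean_space set \<Rightarrow> 'a \<Rightarrow> ('a \<Rightarrow> 'a) \<Rightarrow> 'a" where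
  "arborescence_point P c A =
     (\<Sum>v \<in> vertices P - {opt_vertex P c}. (A v - v) /\<^sub>R (c \<bullet> (A v - v)))"

definition pivot_rule_polytope :: "'a::euclidean_space set \<Rightarrow> 'a \<Rightarrow> 'a set" where
  "pivot_rule_polytope P c = convex hull (arborescence_point P c ` arborescences P c)"

definition nonempty_faces :: "'a::euclidean_space set \<Rightarrow> 'a set set" where
  "nonempty_faces P = {F. F face_of P \<and> F \<noteq> {}}"

text \<open>\<open>Vert r\<close> and \<open>Horiz i\<close> stand for the symbols \<open>L'\<close> with index \<open>r\<close> and \<open>L''\<close> with index \<open>i\<close>.
  A preorder is represented by its graph: \<open>(x, y) \<in> R\<close> means \<open>x \<preceq> y\<close>.\<close>

datatype line = Vert nat | Horiz nat

definition lines :: "nat \<Rightarrow> nat \<Rightarrow> line set" where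
  "lines m n = Vert ` {1..m - 1} \<union> Horiz ` {1..n - 1}"

definition strictly_below :: "'a rel \<Rightarrow> 'a \<Rightarrow> 'a \<Rightarrow> bool" where
  "strictly_below R x y \<longleftrightarrow> (x, y) \<in> R \<and> (y, x) \<notin> R"

definition comparable :: "'a rel \<Rightarrow> 'a \<Rightarrow> 'a \<Rightarrow> bool" where
  "comparable R x y \<longleftrightarrow> (x, y) \<in> R \<or> (y, x) \<in> R"

text \<open>In the next two definitions the family \<open>A\<close>, indexed by \<open>I\<close>, consists of the lines of one
  direction, and \<open>B\<close>, indexed by \<open>J\<close>, of those of the other direction.\<close>

definition orthogonal_link ::
    "'a rel \<Rightarrow> (nat \<Rightarrow> 'a) \<Rightarrow> (nat \<Rightarrow> 'a) \<Rightarrow> nat set \<Rightarrow> nat \<Rightarrow> nat \<Rightarrow> bool" where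
  "orthogonal_link R A B J s t \<longleftrightarrow>
     (\<exists>p\<in>J. ((A s, B p) \<in> R \<and> (B p, A t) \<in> R) \<or> ((A t, B p) \<in> R \<and> (B p, A s) \<in> R))"

definition no_gaps :: "'a rel \<Rightarrow> (nat \<Rightarrow> 'a) \<Rightarrow> nat \<Rightarrow> nat \<Rightarrow> bool" where
  "no_gaps R A s t \<longleftrightarrow>
     \<not> (\<exists>p. min s t < p \<and> p < max s t \<and>
            strictly_below R (A s) (A p) \<and> strictly_below R (A t) (A p))"

definition parallel_condition ::
    "'a rel \<Rightarrow> (nat \<Rightarrow> 'a) \<Rightarrow> nat set \<Rightarrow> (nat \<Rightarrow> 'a) \<Rightarrow> nat set \<Rightarrow> bool" where
  "parallel_condition R A I B J \<longleftrightarrow>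
     (\<forall>s\<in>I. \<forall>t\<in>I. s \<noteq> t \<longrightarrow>
        (comparable R (A s) (A t) \<longleftrightarrow> orthogonal_link R A B J s t \<or> no_gaps R A s t))"

definition good_rectangular :: "nat \<Rightarrow> nat \<Rightarrow> line rel \<Rightarrow> bool" where
  "good_rectangular m n R \<longleftrightarrow>
     preorder_on (lines m n) R \<and>
     (\<forall>r\<in>{1..m - 1}. \<forall>i\<in>{1..n - 1}. comparable R (Vert r) (Horiz i)) \<and>
     parallel_condition R Vert {1..m - 1} Horiz {1..n - 1} \<and>
     parallel_condition R Horiz {1..n - 1} Vert {1..m - 1}"

text \<open>The refinement order on preorders is inclusion of their graphs.\<close>

definition constrainahedron :: "nat \<Rightarrow> nat \<Rightarrow> line rel set" where
  "constrainahedron m n = {R. good_rectangular m n R}"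

definition inclusion_isomorphic :: "'a set set \<Rightarrow> 'b set set \<Rightarrow> bool" where
  "inclusion_isomorphic \<A> \<B> \<longleftrightarrow>
     (\<exists>f. bij_betw f \<A> \<B> \<and> (\<forall>F\<in>\<A>. \<forall>G\<in>\<A>. F \<subseteq> G \<longleftrightarrow> f F \<subseteq> f G))"

end

theory Submission
  imports Defs
begin

text \<open>A direction \<open>w\<close> is maximized over the pivot rule polytope by the arborescences that choose at
  every vertex an improving neighbor of maximal slope, so faces correspond to the possible families
  of sets of such neighbors. Over a product of two simplices, with vertices sorted by \<open>c\<close>, the slopes
  out of vertex \<open>(i, j)\<close> are those of the chords from the \<open>i\<close>-th point of one planar point sequence and
  from the \<open>j\<close>-th point of another one to later points. If \<open>\<sigma> i\<close> is the steepest slope out of point \<open>i\<close>,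
  then a later point \<open>p\<close> is reached with slope \<open>\<sigma> i\<close> iff \<open>\<sigma> p \<le> \<sigma> i\<close> and no point in between has a
  smaller \<open>\<sigma>\<close> than \<open>i\<close>. Hence a face is determined by the order of the numbers \<open>\<sigma> i\<close>, \<open>\<tau> j\<close>, restricted
  to pairs of opposite directions and to pairs of one direction that are not separated by a smaller
  value; this is a good rectangular preorder. Conversely all sequences \<open>\<sigma>\<close>, \<open>\<tau>\<close> occur, and each
  good rectangular preorder arises from the sizes of its up-sets.\<close>

section \<open>Good rectangular preorders from two real sequences\<close>

text \<open>A line with value \<open>x\<close> lies below a line with value \<open>y\<close> if \<open>y \<le> x\<close>: the preorders are reversed
  with respect to slopes. Here \<open>g\<close> gives the values of the lines of one direction and \<open>h\<close> those of
  the other.\<close>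

definition visible :: "(nat \<Rightarrow> real) \<Rightarrow> nat \<Rightarrow> nat \<Rightarrow> bool" where
  "visible g s t \<longleftrightarrow> (\<forall>p. min s t < p \<and> p < max s t \<longrightarrow> min (g s) (g t) \<le> g p)"

definition linked :: "(nat \<Rightarrow> real) \<Rightarrow> (nat \<Rightarrow> real) \<Rightarrow> nat set \<Rightarrow> nat \<Rightarrow> nat \<Rightarrow> bool" where
  "linked g h J s t \<longleftrightarrow> (\<exists>p\<in>J. (h p \<le> g s \<and> g t \<le> h p) \<or> (h p \<le> g t \<and> g s \<le> h p))"

definition related :: "(nat \<Rightarrow> real) \<Rightarrow> (nat \<Rightarrow> real) \<Rightarrow> nat set \<Rightarrow> nat \<Rightarrow> nat \<Rightarrow> bool" where
  "related g h J s t \<longleftrightarrow> g t \<le> g s \<and> (linked g h J s t \<or> visible g s t)"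

lemma related_refl: "related g h J s s"
  by (simp add: related_def visible_def)

text \<open>A link on either half also serves for the whole pair, because the values are monotone
  along the chain. If neither half is linked, both are visible; a point strictly between
  \<open>s\<close> and \<open>u\<close> is then \<open>t\<close> itself or lies strictly inside one
  of the halves, so its value is at least \<open>g u\<close>.\<close>

lemma related_trans:
  assumes "related g h J s t" "related g h J t u"
  shows "related g h J s u"
proof (cases "linked g h J s t \<or> linked g h J t u")
  case True
  have "g t \<le> g s" "g u \<le> g t" using assms by (auto simp: related_def)
  with True have "linked g h J s u"
    unfolding linked_def by (meson order_trans)
  then show ?thesis using \<open>g t \<le> g s\<close> \<open>g u \<le> g t\<close> by (simp add: related_def)
next
  case False
  have le: "g t \<le> g s" "g u \<le> g t" and vis: "visible g s t" "visible g t u"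
    using assms False by (auto simp: related_def)
  have "g u \<le> g p" if "min s u < p" "p < max s u" for p
  proof -
    have "p = t \<or> (min s t < p \<and> p < max s t) \<or> (min t u < p \<and> p < max t u)"
      using that by (auto simp: min_less_iff_disj less_max_iff_disj)
    then consider "p = t" | "min s t < p" "p < max s t" | "min t u < p" "p < max t u"
      by blast
    then show ?thesis
      using vis le unfolding visible_def by cases (auto simp: min_def split: if_splits)
  qed
  then show ?thesis using le by (auto simp: related_def visible_def)
qed

lemma linked_iff_orthogonal_link:
  assumes "\<And>p. p \<in> J \<Longrightarrow> (A s, B p) \<in> R \<longleftrightarrow> h p \<le> g s"
    and "\<And>p. p \<in> J \<Longrightarrow> (B p, A s) \<in> R \<longleftrightarrow> g s \<le> h p"
    and "\<And>p. p \<in> J \<Longrightarrow> (A t, B p) \<in> R \<longleftrightarrow> h p \<le> g t"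
    and "\<And>p. p \<in> J \<Longrightarrow> (B p, A t) \<in> R \<longleftrightarrow> g t \<le> h p"
  shows "orthogonal_link R A B J s t \<longleftrightarrow> linked g h J s t"
  unfolding orthogonal_link_def linked_def using assms by blast

text \<open>The witness is a lowest interior point rather than an arbitrary blocking one: minimality
  makes it visible from both ends, which is what \<open>no_gaps_iff_visible\<close> needs.\<close>

lemma exists_visible_gap:
  assumes "\<not> visible g s t"
  obtains x where "min s t < x" "x < max s t" "g x < g s" "g x < g t"
    "\<And>p. min s t < p \<Longrightarrow> p < max s t \<Longrightarrow> g x \<le> g p"
proof -
  let ?X = "{min s t <..< max s t}"
  obtain y where y: "y \<in> ?X" "g y < min (g s) (g t)"
    using assms unfolding visible_def greaterThanLessThan_iff not_all not_imp not_le by blast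
  then have "Min (g ` ?X) \<in> g ` ?X" by (intro Min_in) auto
  then obtain x where x: "x \<in> ?X" "g x = Min (g ` ?X)" by force
  then have least: "g x \<le> g p" if "p \<in> ?X" for p
    using that by simp
  have "g x < min (g s) (g t)" using least[OF y(1)] y(2) by linarith
  then show ?thesis
    using x(1) least by (intro that[of x]) auto
qed

text \<open>\<open>no_gaps\<close> speaks of strict relations in \<open>R\<close>,
  \<open>visible\<close> of values. A lowest blocking point is visible from \<open>s\<close> and
  from \<open>t\<close>, so \<open>vis\<close> turns it into a gap of \<open>R\<close>. Restricting
  \<open>vis\<close> to visible pairs lets the lemma serve both for preorders built from values and
  for values read off from a preorder.\<close>

lemma no_gaps_iff_visible:
  assumes strict: "\<And>s t. s \<in> {1..k} \<Longrightarrow> t \<in> {1..k} \<Longrightarrow> strictly_below R (A s) (A t) \<Longrightarrow> g t < g s"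
    and vis: "\<And>s t. s \<in> {1..k} \<Longrightarrow> t \<in> {1..k} \<Longrightarrow> visible g s t \<Longrightarrow> g t < g s \<Longrightarrow>
      strictly_below R (A s) (A t)"
    and "s \<in> {1..k}" "t \<in> {1..k}"
  shows "no_gaps R A s t \<longleftrightarrow> visible g s t"
proof
  assume v: "visible g s t"
  have False if "min s t < p" "p < max s t" "strictly_below R (A s) (A p)"
      "strictly_below R (A t) (A p)" for p
  proof -
    have "p \<in> {1..k}" using that assms(3,4) by auto
    then have "g p < g s" "g p < g t" using strict that assms(3,4) by blast+
    moreover have "min (g s) (g t) \<le> g p"
      using v that unfolding visible_def by blast
    ultimately show False by linarith
  qed
  then show "no_gaps R A s t" unfolding no_gaps_def by blast
next
  assume ng: "no_gaps R A s t"
  show "visible g s t"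
  proof (rule ccontr)
    assume "\<not> visible g s t"
    then obtain x where x: "min s t < x" "x < max s t" "g x < g s" "g x < g t"
      and least: "\<And>p. min s t < p \<Longrightarrow> p < max s t \<Longrightarrow> g x \<le> g p"
      by (rule exists_visible_gap) blast
    have "x \<in> {1..k}" using x assms(3,4) by auto
    moreover have "visible g s x" "visible g t x"
      using x unfolding visible_def by (auto intro!: min.coboundedI2 least)
    ultimately have "strictly_below R (A s) (A x)" "strictly_below R (A t) (A x)"
      using vis x assms(3,4) by blast+
    then show False using ng x unfolding no_gaps_def by blast
  qed
qed

text \<open>Being linked and being visible are symmetric conditions, and the comparison of values
  only orients them; so two parallel lines are comparable exactly if they are linked or
  visible.\<close>

lemma parallel_condition_of_related:
  assumes par: "\<And>s t. s \<in> {1..k} \<Longrightarrow> t \<in> {1..k} \<Longrightarrow> (A s, A t) \<in> R \<longleftrightarrow> related g h J s t"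
    and orth1: "\<And>s p. s \<in> {1..k} \<Longrightarrow> p \<in> J \<Longrightarrow> (A s, B p) \<in> R \<longleftrightarrow> h p \<le> g s"
    and orth2: "\<And>s p. s \<in> {1..k} \<Longrightarrow> p \<in> J \<Longrightarrow> (B p, A s) \<in> R \<longleftrightarrow> g s \<le> h p"
  shows "parallel_condition R A {1..k} B J"
proof -
  have sym: "linked g h J s t \<longleftrightarrow> linked g h J t s" "visible g s t \<longleftrightarrow> visible g t s" for s t
    unfolding linked_def visible_def by (blast, simp add: min.commute max.commute)
  have "comparable R (A s) (A t) \<longleftrightarrow> orthogonal_link R A B J s t \<or> no_gaps R A s t"
    if st: "s \<in> {1..k}" "t \<in> {1..k}" for s t
  proof -
    have "no_gaps R A s t \<longleftrightarrow> visible g s t"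
    proof (rule no_gaps_iff_visible[OF _ _ st])
      show "g t < g s" if "s \<in> {1..k}" "t \<in> {1..k}" "strictly_below R (A s) (A t)" for s t
        using that par[of s t] par[of t s] sym[of s t]
        by (auto simp: strictly_below_def related_def not_le)
      show "strictly_below R (A s) (A t)"
        if "s \<in> {1..k}" "t \<in> {1..k}" "visible g s t" "g t < g s" for s t
        using that par[of s t] par[of t s] by (auto simp: strictly_below_def related_def)
    qed
    moreover have "orthogonal_link R A B J s t \<longleftrightarrow> linked g h J s t"
      using st by (intro linked_iff_orthogonal_link orth1 orth2)
    moreover have "comparable R (A s) (A t) \<longleftrightarrow> linked g h J s t \<or> visible g s t"
      using par st sym[of s t] by (auto simp: comparable_def related_def)
    ultimately show ?thesis by simp
  qed
  then show ?thesis by (simp add: parallel_condition_def)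
qed

text \<open>The converse passage: for a given \<open>R\<close>, any \<open>g\<close> that is
  antitone and strictly so along \<open>R\<close>, and exact against the orthogonal lines, already
  determines \<open>R\<close> on parallel lines. The parallel condition settles which pairs are
  comparable, and \<open>g\<close> settles their orientation.\<close>

lemma related_of_parallel_condition:
  assumes pc: "parallel_condition R A {1..k} B J"
    and refl: "\<And>s. s \<in> {1..k} \<Longrightarrow> (A s, A s) \<in> R"
    and mono: "\<And>s t. s \<in> {1..k} \<Longrightarrow> t \<in> {1..k} \<Longrightarrow> (A s, A t) \<in> R \<Longrightarrow> g t \<le> g s"
    and strict: "\<And>s t. s \<in> {1..k} \<Longrightarrow> t \<in> {1..k} \<Longrightarrow> strictly_below R (A s) (A t) \<Longrightarrow> g t < g s"
    and orth1: "\<And>s p. s \<in> {1..k} \<Longrightarrow> p \<in> J \<Longrightarrow> (A s, B p) \<in> R \<longleftrightarrow> h p \<le> g s"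
    and orth2: "\<And>s p. s \<in> {1..k} \<Longrightarrow> p \<in> J \<Longrightarrow> (B p, A s) \<in> R \<longleftrightarrow> g s \<le> h p"
    and st: "s \<in> {1..k}" "t \<in> {1..k}"
  shows "(A s, A t) \<in> R \<longleftrightarrow> related g h J s t"
proof (cases "s = t")
  case True
  then show ?thesis using refl st by (simp add: related_refl)
next
  case False
  have "no_gaps R A s t \<longleftrightarrow> visible g s t"
  proof (rule no_gaps_iff_visible[OF strict _ st])
    show "strictly_below R (A s) (A t)"
      if s: "s \<in> {1..k}" and t: "t \<in> {1..k}" and vis: "visible g s t" and less: "g t < g s" for s t
    proof -
      \<comment> \<open>A gap between visible lines would have value below \<open>g t\<close>,
        against visibility. So the parallel condition makes the pair comparable, and
        \<open>mono\<close> excludes the wrong orientation.\<close>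
      have False if "min s t < p" "p < max s t" "strictly_below R (A s) (A p)"
          "strictly_below R (A t) (A p)" for p
      proof -
        have "p \<in> {1..k}" using that s t by auto
        then have "g p < g t" using strict[OF t] that by blast
        moreover have "g t \<le> g p"
          using vis that less unfolding visible_def by (metis min.absorb4)
        ultimately show False by linarith
      qed
      then have "no_gaps R A s t" unfolding no_gaps_def by blast
      then have "comparable R (A s) (A t)"
        using pc[unfolded parallel_condition_def, rule_format, OF s t] less by fastforce
      then show ?thesis
        using mono[OF t s] less by (auto simp: comparable_def strictly_below_def)
    qed
  qed
  moreover have "orthogonal_link R A B J s t \<longleftrightarrow> linked g h J s t"
    using st by (intro linked_iff_orthogonal_link orth1 orth2)
  ultimately have "comparable R (A s) (A t) \<longleftrightarrow> linked g h J s t \<or> visible g s t"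
    using pc[unfolded parallel_condition_def, rule_format, OF st False] by simp
  \<comment> \<open>If only the reverse relation held, it would be strict and force
    \<open>g s < g t\<close>.\<close>
  moreover have "(A s, A t) \<in> R \<longleftrightarrow> g t \<le> g s \<and> comparable R (A s) (A t)"
    using mono[OF st] strict[OF st(2,1)] unfolding comparable_def strictly_below_def
    by (meson not_le)
  ultimately show ?thesis by (simp add: related_def)
qed

section \<open>The preorder of a pair of value sequences\<close>

fun line_le :: "nat \<Rightarrow> nat \<Rightarrow> (nat \<Rightarrow> real) \<Rightarrow> (nat \<Rightarrow> real) \<Rightarrow> line \<Rightarrow> line \<Rightarrow> bool" where
  "line_le m n g h (Vert s) (Vert t) \<longleftrightarrow> related g h {1..n - 1} s t"
| "line_le m n g h (Horiz i) (Horiz j) \<longleftrightarrow> related h g {1..m - 1} i j"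
| "line_le m n g h (Vert s) (Horiz j) \<longleftrightarrow> h j \<le> g s"
| "line_le m n g h (Horiz i) (Vert t) \<longleftrightarrow> g t \<le> h i"

definition slope_preorder :: "nat \<Rightarrow> nat \<Rightarrow> (nat \<Rightarrow> real) \<Rightarrow> (nat \<Rightarrow> real) \<Rightarrow> line rel" where
  "slope_preorder m n g h =
     {(x, y). x \<in> lines m n \<and> y \<in> lines m n \<and> line_le m n g h x y}"

lemma Vert_in_lines [simp]: "Vert s \<in> lines m n \<longleftrightarrow> s \<in> {1..m - 1}"
  and Horiz_in_lines [simp]: "Horiz i \<in> lines m n \<longleftrightarrow> i \<in> {1..n - 1}"
  by (auto simp: lines_def)

lemma related_imp_le: "related g h J s t \<Longrightarrow> g t \<le> g s"
  by (simp add: related_def)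

lemma related_via: "h p \<le> g s \<Longrightarrow> g t \<le> h p \<Longrightarrow> p \<in> J \<Longrightarrow> related g h J s t"
  by (auto simp: related_def linked_def)

text \<open>The one case beyond \<open>related_trans\<close> and transitivity of values is a
  parallel pair joined through an orthogonal line; that line is itself a link, whence
  \<open>related_via\<close>.\<close>

lemma line_le_trans:
  assumes "x \<in> lines m n" "y \<in> lines m n" "z \<in> lines m n"
    and "line_le m n g h x y" "line_le m n g h y z"
  shows "line_le m n g h x z"
  using assms
  by (cases x; cases y; cases z)
     (auto intro: related_trans related_via order_trans dest: related_imp_le
       simp del: atLeastAtMost_iff)

lemma good_rectangular_slope_preorder: "good_rectangular m n (slope_preorder m n g h)"
proof -
  let ?R = "slope_preorder m n g h"
  have "line_le m n g h x x" for x
    by (cases x) (simp_all add: related_refl)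
  then have "preorder_on (lines m n) ?R"
    unfolding preorder_on_def
    by (auto simp: slope_preorder_def refl_on_def intro!: transI intro: line_le_trans)
  moreover have "comparable ?R (Vert r) (Horiz i)" if "r \<in> {1..m - 1}" "i \<in> {1..n - 1}" for r i
    using that by (auto simp: comparable_def slope_preorder_def)
  moreover have "parallel_condition ?R Vert {1..m - 1} Horiz {1..n - 1}"
    by (rule parallel_condition_of_related[where g = g and h = h])
      (simp_all add: slope_preorder_def)
  moreover have "parallel_condition ?R Horiz {1..n - 1} Vert {1..m - 1}"
    by (rule parallel_condition_of_related[where g = h and h = g])
      (simp_all add: slope_preorder_def)
  ultimately show ?thesis by (simp add: good_rectangular_def)
qed

lemma good_rectangular_imp_slope_preorder:
  assumes "good_rectangular m n R"
  obtains g h where "R = slope_preorder m n g h"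
proof -
  \<comment> \<open>Any strictly antitone real-valued map on the preorder would do.\<close>
  let ?f = "\<lambda>x. real (card {y. (x, y) \<in> R})"
  have sub: "R \<subseteq> lines m n \<times> lines m n" and refl: "refl_on (lines m n) R" and "trans R"
    and orth: "\<And>r i. r \<in> {1..m - 1} \<Longrightarrow> i \<in> {1..n - 1} \<Longrightarrow> comparable R (Vert r) (Horiz i)"
    and pcV: "parallel_condition R Vert {1..m - 1} Horiz {1..n - 1}"
    and pcH: "parallel_condition R Horiz {1..n - 1} Vert {1..m - 1}"
    using assms by (auto simp: good_rectangular_def preorder_on_def)
  have reflD: "(x, x) \<in> R" if "x \<in> lines m n" for x
    using refl that by (simp add: refl_onD)
  have "finite (lines m n)" by (simp add: lines_def)
  then have fin: "finite {y. (x, y) \<in> R}" for x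
    by (rule rev_finite_subset) (use sub in auto)
  have mono: "?f y \<le> ?f x" if "(x, y) \<in> R" for x y
    using that \<open>trans R\<close> by (auto intro!: card_mono fin dest: transD)
  have strict: "?f y < ?f x" if "strictly_below R x y" for x y
  proof -
    have "{z. (y, z) \<in> R} \<subset> {z. (x, z) \<in> R}"
      using that sub \<open>trans R\<close> reflD[of x] by (auto simp: strictly_below_def dest: transD)
    then show ?thesis by (simp add: psubset_card_mono fin)
  qed
  have iff: "(x, y) \<in> R \<longleftrightarrow> ?f y \<le> ?f x" if "comparable R x y" for x y
    using that mono[of x y] strict[of y x] unfolding comparable_def strictly_below_def
    by (meson not_le)
  \<comment> \<open>Orthogonal lines are always comparable, so here the sizes of the up-sets
    determine \<open>R\<close> completely.\<close>
  have orth': "(Vert r, Horiz i) \<in> R \<longleftrightarrow> ?f (Horiz i) \<le> ?f (Vert r)"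
      "(Horiz i, Vert r) \<in> R \<longleftrightarrow> ?f (Vert r) \<le> ?f (Horiz i)"
    if "r \<in> {1..m - 1}" "i \<in> {1..n - 1}" for r i
    using iff[of "Vert r" "Horiz i"] iff[of "Horiz i" "Vert r"] orth[OF that]
    by (auto simp: comparable_def)
  let ?g = "\<lambda>s. ?f (Vert s)" and ?h = "\<lambda>s. ?f (Horiz s)"
  have V: "(Vert s, Vert t) \<in> R \<longleftrightarrow> related ?g ?h {1..n - 1} s t"
    if "s \<in> {1..m - 1}" "t \<in> {1..m - 1}" for s t
    by (rule related_of_parallel_condition[OF pcV _ mono strict orth' that])
       (use reflD in simp_all)
  have H: "(Horiz s, Horiz t) \<in> R \<longleftrightarrow> related ?h ?g {1..m - 1} s t"
    if "s \<in> {1..n - 1}" "t \<in> {1..n - 1}" for s t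
    by (rule related_of_parallel_condition[OF pcH _ mono strict orth'(2,1) that])
       (use reflD in simp_all)
  have eq: "(x, y) \<in> R \<longleftrightarrow> (x, y) \<in> slope_preorder m n ?g ?h" for x y
  proof (cases "x \<in> lines m n \<and> y \<in> lines m n")
    case True
    then show ?thesis
      by (cases x; cases y) (simp_all add: slope_preorder_def V H orth' del: of_nat_le_iff)
  next
    case False
    then show ?thesis using sub by (auto simp: slope_preorder_def)
  qed
  have "R = slope_preorder m n ?g ?h"
    by (intro subset_antisym subrelI) (rule iffD1[OF eq], assumption, rule iffD2[OF eq], assumption)
  then show ?thesis by (rule that)
qed

section \<open>Steepest chords\<close>

definition chord :: "(nat \<Rightarrow> real) \<Rightarrow> (nat \<Rightarrow> real) \<Rightarrow> nat \<Rightarrow> nat \<Rightarrow> real" where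
  "chord \<alpha> w s p = (w p - w s) / (\<alpha> p - \<alpha> s)"

definition steepest :: "nat \<Rightarrow> (nat \<Rightarrow> real) \<Rightarrow> (nat \<Rightarrow> real) \<Rightarrow> nat \<Rightarrow> real" where
  "steepest k \<alpha> w s = Max (chord \<alpha> w s ` {s<..k})"

text \<open>The points after \<open>s\<close> reached by a steepest chord from \<open>s\<close>, read off from the order of the
  steepest slopes \<open>g\<close> alone. The last point \<open>k\<close> has no steepest slope, so the value \<open>g k\<close> is junk.\<close>

definition targets :: "nat \<Rightarrow> (nat \<Rightarrow> real) \<Rightarrow> nat \<Rightarrow> nat set" where
  "targets k g s =
     {p. s < p \<and> p \<le> k \<and> (p < k \<longrightarrow> g p \<le> g s) \<and> (\<forall>x. s < x \<and> x < p \<longrightarrow> g s \<le> g x)}"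

lemma chord_le_steepest: "s < p \<Longrightarrow> p \<le> k \<Longrightarrow> chord \<alpha> w s p \<le> steepest k \<alpha> w s"
  by (simp add: steepest_def)

lemma steepest_attained:
  assumes "s < k"
  obtains p where "s < p" "p \<le> k" "chord \<alpha> w s p = steepest k \<alpha> w s"
proof -
  have "steepest k \<alpha> w s \<in> chord \<alpha> w s ` {s<..k}"
    unfolding steepest_def using assms by (intro Max_in) auto
  then show ?thesis using that by auto
qed

lemma chord_le_iff:
  assumes "strict_mono_on {1..k} \<alpha>" "1 \<le> s" "s < p" "p \<le> k"
  shows "chord \<alpha> w s p \<le> z \<longleftrightarrow> w p - w s \<le> z * (\<alpha> p - \<alpha> s)"
    and "z \<le> chord \<alpha> w s p \<longleftrightarrow> z * (\<alpha> p - \<alpha> s) \<le> w p - w s"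
    and "chord \<alpha> w s p = z \<longleftrightarrow> w p - w s = z * (\<alpha> p - \<alpha> s)"
proof -
  have "\<alpha> s < \<alpha> p" using assms by (auto intro: strict_mono_onD)
  then show "chord \<alpha> w s p \<le> z \<longleftrightarrow> w p - w s \<le> z * (\<alpha> p - \<alpha> s)"
    "z \<le> chord \<alpha> w s p \<longleftrightarrow> z * (\<alpha> p - \<alpha> s) \<le> w p - w s"
    "chord \<alpha> w s p = z \<longleftrightarrow> w p - w s = z * (\<alpha> p - \<alpha> s)"
    by (simp_all add: chord_def pos_divide_le_eq pos_le_divide_eq divide_eq_eq)
qed

text \<open>Points after \<open>s\<close> lie on or below the line through point \<open>s\<close> of
  slope \<open>steepest k \<alpha> w s\<close>, and point \<open>p\<close> lies on it. Hence chords
  leaving \<open>p\<close> are at most that steep, and chords into \<open>p\<close> from points in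
  between are at least that steep.\<close>

lemma chord_eq_steepest_imp_targets:
  assumes \<alpha>: "strict_mono_on {1..k} \<alpha>" and s: "1 \<le> s" "s < p" "p \<le> k"
    and eq: "chord \<alpha> w s p = steepest k \<alpha> w s"
  shows "p \<in> targets k (steepest k \<alpha> w) s"
proof -
  let ?z = "steepest k \<alpha> w"
  have wp: "w p - w s = ?z s * (\<alpha> p - \<alpha> s)"
    using chord_le_iff(3)[OF \<alpha> s] eq by simp
  have le: "w x - w s \<le> ?z s * (\<alpha> x - \<alpha> s)" if "s < x" "x \<le> k" for x
    using chord_le_steepest[OF that] chord_le_iff(1)[OF \<alpha> s(1) that] by blast
  have "?z p \<le> ?z s" if "p < k"
  proof -
    obtain q where q: "p < q" "q \<le> k" "chord \<alpha> w p q = ?z p"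
      using steepest_attained[OF \<open>p < k\<close>] by blast
    then have "chord \<alpha> w p q \<le> ?z s"
      using wp le[of q] s chord_le_iff(1)[OF \<alpha>, of p q w "?z s"] by (simp add: algebra_simps)
    then show ?thesis using q by simp
  qed
  moreover have "?z s \<le> ?z x" if "s < x" "x < p" for x
  proof -
    have "?z s \<le> chord \<alpha> w x p"
      using wp le[of x] s that chord_le_iff(2)[OF \<alpha>, of x p "?z s" w] by (simp add: algebra_simps)
    then show ?thesis using chord_le_steepest[of x p k \<alpha> w] that s by linarith
  qed
  ultimately show ?thesis using s by (simp add: targets_def)
qed

text \<open>The order of the steepest slopes alone thus tells where steepest chords end. For the
  forward implication, \<open>p\<close> is compared with \<open>r\<close>, the last point on the
  supporting line from \<open>s\<close>.\<close>

lemma targets_steepest_iff: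
  assumes \<alpha>: "strict_mono_on {1..k} \<alpha>" and s: "1 \<le> s" "s < k"
  shows "p \<in> targets k (steepest k \<alpha> w) s \<longleftrightarrow>
    s < p \<and> p \<le> k \<and> chord \<alpha> w s p = steepest k \<alpha> w s"
proof
  let ?z = "steepest k \<alpha> w"
  let ?T = "{p. s < p \<and> p \<le> k \<and> chord \<alpha> w s p = ?z s}"
  assume "p \<in> targets k ?z s"
  then have p: "s < p" "p \<le> k" "p < k \<Longrightarrow> ?z p \<le> ?z s"
    and between: "\<And>x. s < x \<Longrightarrow> x < p \<Longrightarrow> ?z s \<le> ?z x"
    by (auto simp: targets_def)
  have "finite ?T" "?T \<noteq> {}"
    using steepest_attained[OF s(2), where \<alpha> = \<alpha> and w = w] by (auto intro: finite_subset[of _ "{..k}"])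
  then obtain r where r: "r \<in> ?T" and r_max: "\<And>q. q \<in> ?T \<Longrightarrow> q \<le> r"
    using Max_in Max_ge by blast
  have wr: "w r - w s = ?z s * (\<alpha> r - \<alpha> s)"
    using chord_le_iff(3)[OF \<alpha> s(1)] r by auto
  \<comment> \<open>If \<open>r\<close> came before \<open>p\<close>, the target conditions at
    \<open>r\<close> and at \<open>p\<close> would give \<open>?z r = ?z s\<close>; a steepest chord
    from \<open>r\<close> would then continue the supporting line to a later contact point.\<close>
  have "p \<le> r"
  proof (rule ccontr)
    assume "\<not> p \<le> r"
    then have "r < p" "r < k" using p by auto
    have "r \<in> targets k ?z s"
      using chord_eq_steepest_imp_targets[OF \<alpha> s(1)] r by auto
    then have zr: "?z r = ?z s"
      using between[of r] \<open>r < p\<close> \<open>r < k\<close> r by (force simp: targets_def)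
    obtain q where q: "r < q" "q \<le> k" "chord \<alpha> w r q = ?z r"
      using steepest_attained[OF \<open>r < k\<close>] by blast
    then have "w q - w r = ?z s * (\<alpha> q - \<alpha> r)"
      using chord_le_iff(3)[OF \<alpha>, of r q w "?z s"] zr r s by auto
    then have "chord \<alpha> w s q = ?z s"
      using chord_le_iff(3)[OF \<alpha> s(1), of q w "?z s"] wr q r by (simp add: algebra_simps)
    then show False using r_max[of q] q r by auto
  qed
  show "s < p \<and> p \<le> k \<and> chord \<alpha> w s p = ?z s"
  proof (cases "p = r")
    case True
    then show ?thesis using r by simp
  next
    case False
    then have "p < r" "p < k" using \<open>p \<le> r\<close> r by auto
    \<comment> \<open>As \<open>?z p <= ?z s\<close> and \<open>r\<close> is on the supporting line,
      \<open>p\<close> cannot lie below that line; it never lies above it.\<close>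
    then have "chord \<alpha> w p r \<le> ?z s"
      using chord_le_steepest[of p r k \<alpha> w] p r by auto
    then have "w r - w p \<le> ?z s * (\<alpha> r - \<alpha> p)"
      using chord_le_iff(1)[OF \<alpha>, of p r w "?z s"] p s r \<open>p < r\<close> by auto
    then have "?z s \<le> chord \<alpha> w s p"
      using chord_le_iff(2)[OF \<alpha> s(1), of p "?z s" w] p wr by (simp add: algebra_simps)
    then show ?thesis using chord_le_steepest[of s p k \<alpha> w] p by simp
  qed
next
  assume "s < p \<and> p \<le> k \<and> chord \<alpha> w s p = steepest k \<alpha> w s"
  then show "p \<in> targets k (steepest k \<alpha> w) s"
    using chord_eq_steepest_imp_targets[OF \<alpha> s(1)] by blast
qed

text \<open>The steepest slope at \<open>s\<close> involves only the points from \<open>s\<close>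
  on, so heights can be chosen from right to left; \<open>j\<close> counts the positions before
  \<open>k\<close> already settled.\<close>

lemma exists_steepest:
  assumes \<alpha>: "strict_mono_on {1..k} \<alpha>"
  obtains w where "\<And>s. 1 \<le> s \<Longrightarrow> s < k \<Longrightarrow> steepest k \<alpha> w s = g s"
proof -
  have "\<exists>w. \<forall>s. 1 \<le> s \<and> s < k \<and> k \<le> s + j \<longrightarrow> steepest k \<alpha> w s = g s" for j
  proof (induction j)
    case 0
    then show ?case by auto
  next
    case (Suc j)
    then obtain w where w: "\<And>s. 1 \<le> s \<Longrightarrow> s < k \<Longrightarrow> k \<le> s + j \<Longrightarrow> steepest k \<alpha> w s = g s"
      by blast
    \<comment> \<open>Lowering the height of \<open>s0\<close> does not affect the slopes to its right.\<close>
    define s0 where "s0 = k - Suc j"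
    let ?F = "\<lambda>p. w p - g s0 * (\<alpha> p - \<alpha> s0)"
    \<comment> \<open>At this height the line of slope \<open>g s0\<close> through point
      \<open>s0\<close> touches the later points from above.\<close>
    define w' where "w' = w(s0 := Max (?F ` {s0<..k}))"
    have old: "steepest k \<alpha> w' s = steepest k \<alpha> w s" if "s0 < s" for s
      unfolding steepest_def chord_def w'_def using that
      by (intro arg_cong[where f = Max] image_cong) auto
    have new: "steepest k \<alpha> w' s0 = g s0" if s0: "1 \<le> s0" "s0 < k"
    proof -
      have ub: "w p - w' s0 \<le> g s0 * (\<alpha> p - \<alpha> s0)" if "s0 < p" "p \<le> k" for p
      proof -
        have "?F p \<le> w' s0" using that by (auto simp: w'_def)
        then show ?thesis by simp
      qed
      have "w' s0 \<in> ?F ` {s0<..k}"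
        unfolding w'_def fun_upd_same using s0 by (intro Max_in) auto
      then obtain q where q: "s0 < q" "q \<le> k" "w q - w' s0 = g s0 * (\<alpha> q - \<alpha> s0)" by auto
      have same: "w' p = w p" if "s0 < p" for p using that by (simp add: w'_def)
      obtain p where p: "s0 < p" "p \<le> k" "chord \<alpha> w' s0 p = steepest k \<alpha> w' s0"
        using steepest_attained[OF s0(2)] by blast
      have "chord \<alpha> w' s0 p \<le> g s0"
        using chord_le_iff(1)[OF \<alpha> s0(1) p(1,2)] ub[OF p(1,2)] same[OF p(1)] by simp
      moreover have "chord \<alpha> w' s0 q = g s0"
        using chord_le_iff(3)[OF \<alpha> s0(1) q(1,2)] q(3) same[OF q(1)] by simp
      moreover have "chord \<alpha> w' s0 q \<le> steepest k \<alpha> w' s0"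
        using q by (simp add: chord_le_steepest)
      ultimately show ?thesis using p(3) by simp
    qed
    have "steepest k \<alpha> w' s = g s" if "1 \<le> s" "s < k" "k \<le> s + Suc j" for s
    proof (cases "k \<le> s + j")
      case True
      then show ?thesis using old[of s] w[of s] that by (simp add: s0_def)
    next
      case False
      then have "s = s0" using that by (simp add: s0_def)
      then show ?thesis using new that by simp
    qed
    then show ?case by blast
  qed
  from this[of k] show ?thesis using that by auto
qed

section \<open>Inclusion of preorders in terms of targets\<close>

text \<open>Membership of \<open>p\<close> in the targets of \<open>s\<close> is a conjunction of
  relations that hold by visibility: \<open>s\<close> to \<open>p\<close>, when
  \<open>p < k\<close>, and every point in between to \<open>s\<close>. All of these carry over to
  \<open>g'\<close>.\<close>

lemma targets_mono:
  assumes sub: "\<And>s t. s \<in> {1..<k} \<Longrightarrow> t \<in> {1..<k} \<Longrightarrow> related g h J s t \<Longrightarrow> related g' h' J s t"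
    and s: "s \<in> {1..<k}"
  shows "targets k g s \<subseteq> targets k g' s"
proof
  fix p assume "p \<in> targets k g s"
  then have p: "s < p" "p \<le> k" "p < k \<Longrightarrow> g p \<le> g s"
    and between: "\<And>x. s < x \<Longrightarrow> x < p \<Longrightarrow> g s \<le> g x"
    by (auto simp: targets_def)
  have "g' p \<le> g' s" if "p < k"
  proof -
    have "related g h J s p"
      using p that between by (force simp: related_def visible_def)
    then show ?thesis using sub[of s p] s p that by (simp add: related_def)
  qed
  moreover have "g' s \<le> g' x" if "s < x" "x < p" for x
  proof -
    have "related g h J x s"
      using that between by (force simp: related_def visible_def)
    then show ?thesis using sub[of x s] s p that by (simp add: related_def)
  qed
  ultimately show "p \<in> targets k g' s" using p by (simp add: targets_def)
qed

text \<open>Links carry over through the orthogonal comparisons. For visible pairs, targets look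
  only to the right, so the two orders of \<open>s\<close> and \<open>t\<close> need different
  arguments: a chain of targets from \<open>s\<close> to \<open>t\<close>, or a single target of
  \<open>t\<close> beyond \<open>s\<close>.\<close>

lemma related_mono:
  assumes tgt: "\<And>s. s \<in> {1..<k} \<Longrightarrow> targets k g s \<subseteq> targets k g' s"
    and orth1: "\<And>s p. s \<in> {1..<k} \<Longrightarrow> p \<in> J \<Longrightarrow> h p \<le> g s \<Longrightarrow> h' p \<le> g' s"
    and orth2: "\<And>s p. s \<in> {1..<k} \<Longrightarrow> p \<in> J \<Longrightarrow> g s \<le> h p \<Longrightarrow> g' s \<le> h' p"
    and "s \<in> {1..<k}" "t \<in> {1..<k}" "related g h J s t"
  shows "related g' h' J s t"
proof (cases "linked g h J s t")
  case True
  then obtain p where p: "p \<in> J" "h p \<le> g s" "g t \<le> h p"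
    using assms(6) by (auto simp: linked_def related_def)
  then have "h' p \<le> g' s" "g' t \<le> h' p" using assms by blast+
  then show ?thesis using p by (auto simp: related_def linked_def)
next
  case False
  then have "visible g s t" "g t \<le> g s" using assms(6) by (auto simp: related_def)
  with assms(4,5) show ?thesis
  \<comment> \<open>The subtraction is truncated; the induction hypothesis is applied only when
    \<open>s < t\<close>.\<close>
  proof (induction "t - s" arbitrary: s rule: less_induct)
    case less
    then have vis: "\<And>p. min s t < p \<Longrightarrow> p < max s t \<Longrightarrow> g t \<le> g p"
      by (force simp: visible_def)
    consider "s = t" | "s < t" | "t < s" by linarith
    then show ?case
    proof cases
      case 1
      then show ?thesis by (simp add: related_refl)
    next
      case 2
      \<comment> \<open>The first target of \<open>s\<close>; following first targets from \<open>s\<close> leads to \<open>t\<close>.\<close>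
      define x where "x = (LEAST x. s < x \<and> g x \<le> g s)"
      have x: "s < x" "g x \<le> g s" "x \<le> t"
        using LeastI[of "\<lambda>x. s < x \<and> g x \<le> g s" t] Least_le[of "\<lambda>x. s < x \<and> g x \<le> g s" t]
          2 less.prems(4) by (auto simp: x_def)
      have "g s \<le> g y" if "s < y" "y < x" for y
        using not_less_Least[of y "\<lambda>x. s < x \<and> g x \<le> g s"] that by (auto simp: x_def)
      then have "x \<in> targets k g s"
        using x less.prems by (simp add: targets_def)
      then have "x \<in> targets k g' s" using tgt less.prems by blast
      then have "related g' h' J s x"
        using x less.prems by (force simp: targets_def related_def visible_def)
      moreover have "related g' h' J x t"
      proof (rule less.hyps)
        have "g t \<le> g x" using vis[of x] x by (cases "x = t") auto
        then show "g t \<le> g x" "visible g x t"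
          using vis x by (auto simp: visible_def intro!: min.coboundedI2)
      qed (use x 2 less.prems in auto)
      ultimately show ?thesis by (rule related_trans)
    next
      case 3
      \<comment> \<open>The last target of \<open>t\<close>, which lies beyond \<open>s\<close>.\<close>
      define x where "x = (LEAST x. t < x \<and> (x = k \<or> g x < g t))"
      have x: "t < x" "x = k \<or> g x < g t" "x \<le> k"
        using LeastI[of "\<lambda>x. t < x \<and> (x = k \<or> g x < g t)" k]
          Least_le[of "\<lambda>x. t < x \<and> (x = k \<or> g x < g t)" k] less.prems by (auto simp: x_def)
      have before: "g t \<le> g y" if "t < y" "y < x" for y
        using not_less_Least[of y "\<lambda>x. t < x \<and> (x = k \<or> g x < g t)"] that by (auto simp: x_def)
      \<comment> \<open>Otherwise \<open>x\<close> would be \<open>s\<close> or a point between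
        \<open>t\<close> and \<open>s\<close> with value less than \<open>g t\<close>, against
        \<open>g t <= g s\<close> or visibility.\<close>
      have "s < x"
      proof (rule ccontr)
        assume "\<not> s < x"
        then have "x \<le> s" "x \<noteq> k" using less.prems by auto
        then show False using x vis[of x] less.prems by (cases "x = s") auto
      qed
      have "x \<in> targets k g t"
        using x before by (auto simp: targets_def)
      then have "x \<in> targets k g' t" using tgt less.prems by blast
      then have "\<And>y. t < y \<Longrightarrow> y < x \<Longrightarrow> g' t \<le> g' y" by (auto simp: targets_def)
      then show ?thesis
        using 3 \<open>s < x\<close> by (auto simp: related_def visible_def intro!: min.coboundedI2)
    qed
  qed
qed

text \<open>Trades the preorders for data attached to single points and orthogonal pairs, the form
  in which pivot choices reveal them.\<close>

lemma slope_preorder_subset_iff: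
  "slope_preorder m n g h \<subseteq> slope_preorder m n g' h' \<longleftrightarrow>
     (\<forall>s\<in>{1..<m}. targets m g s \<subseteq> targets m g' s) \<and>
     (\<forall>i\<in>{1..<n}. targets n h i \<subseteq> targets n h' i) \<and>
     (\<forall>s\<in>{1..<m}. \<forall>i\<in>{1..<n}. (h i \<le> g s \<longrightarrow> h' i \<le> g' s) \<and> (g s \<le> h i \<longrightarrow> g' s \<le> h' i))"
  (is "?L \<longleftrightarrow> ?R")
proof -
  have I: "{1..m - 1} = {1..<m}" "{1..n - 1} = {1..<n}" by auto
  have ex: "slope_preorder m n g h \<subseteq> slope_preorder m n g' h' \<longleftrightarrow>
     (\<forall>s\<in>{1..<m}. \<forall>t\<in>{1..<m}. related g h {1..<n} s t \<longrightarrow> related g' h' {1..<n} s t) \<and>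
     (\<forall>s\<in>{1..<n}. \<forall>t\<in>{1..<n}. related h g {1..<m} s t \<longrightarrow> related h' g' {1..<m} s t) \<and>
     (\<forall>s\<in>{1..<m}. \<forall>i\<in>{1..<n}. (h i \<le> g s \<longrightarrow> h' i \<le> g' s) \<and> (g s \<le> h i \<longrightarrow> g' s \<le> h' i))"
    (is "_ \<longleftrightarrow> ?X")
  proof
    assume L: ?L
    have "line_le m n g h x y \<longrightarrow> line_le m n g' h' x y" if "x \<in> lines m n" "y \<in> lines m n" for x y
      using L that by (auto simp: slope_preorder_def)
    from this[of "Vert _" "Vert _"] this[of "Horiz _" "Horiz _"]
      this[of "Vert _" "Horiz _"] this[of "Horiz _" "Vert _"]
    show ?X by (simp only: line_le.simps Vert_in_lines Horiz_in_lines I) blast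
  next
    assume X: ?X
    have "line_le m n g' h' x y" if "x \<in> lines m n" "y \<in> lines m n" "line_le m n g h x y" for x y
      using that X by (cases x; cases y) (auto simp: I simp del: atLeastLessThan_iff One_nat_def)
    then show ?L by (auto simp: slope_preorder_def)
  qed
  show ?thesis
  proof
    assume ?L
    then show ?R unfolding ex
      using targets_mono[of m g h "{1..<n}" g' h'] targets_mono[of n h g "{1..<m}" h' g'] by blast
  next
    assume ?R
    then show ?L unfolding ex
      using related_mono[of m g g' "{1..<n}" h h'] related_mono[of n h h' "{1..<m}" g g'] by blast
  qed
qed

section \<open>Pivot choices on the grid\<close>

text \<open>These are to be the neighbors of maximal slope out of grid vertex \<open>(i, j)\<close>.
  The guards handle the last row and column, where one direction has no step and the values
  \<open>g m\<close> and \<open>h n\<close> are junk.\<close>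

definition steps :: "nat \<Rightarrow> nat \<Rightarrow> (nat \<Rightarrow> real) \<Rightarrow> (nat \<Rightarrow> real) \<Rightarrow> nat \<times> nat \<Rightarrow> (nat \<times> nat) set" where
  "steps m n g h = (\<lambda>(i, j).
     {(p, j) | p. i < m \<and> p \<in> targets m g i \<and> (j < n \<longrightarrow> h j \<le> g i)} \<union>
     {(i, q) | q. j < n \<and> q \<in> targets n h j \<and> (i < m \<longrightarrow> g i \<le> h j)})"

text \<open>Values at the last indices are irrelevant, which matters because
  \<open>exists_steepest\<close> prescribes slopes only before the last point.\<close>

lemma slope_preorder_cong:
  assumes "\<And>s. s \<in> {1..<m} \<Longrightarrow> g s = g' s" "\<And>s. s \<in> {1..<n} \<Longrightarrow> h s = h' s"
  shows "slope_preorder m n g h = slope_preorder m n g' h'"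
proof -
  have cong: "targets k g s = targets k g' s"
    if "s \<in> {1..<k}" "\<And>s. s \<in> {1..<k} \<Longrightarrow> g s = g' s" for g g' k s
    unfolding targets_def using that by (intro Collect_cong) auto
  have "targets m g s = targets m g' s" if "s \<in> {1..<m}" for s
    using that assms(1) by (rule cong)
  moreover have "targets n h s = targets n h' s" if "s \<in> {1..<n}" for s
    using that assms(2) by (rule cong)
  ultimately show ?thesis
    by (intro equalityI; unfold slope_preorder_subset_iff) (simp_all add: assms)
qed

lemma targets_subset: "targets k g s \<subseteq> {s<..k}"
  by (auto simp: targets_def)

lemma targets_nonempty:
  assumes "s < k"
  shows "targets k g s \<noteq> {}"
proof -
  let ?Q = "\<lambda>x. s < x \<and> (x = k \<or> g x \<le> g s)"
  define p where "p = (LEAST x. ?Q x)"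
  have "?Q p" "p \<le> k"
    using LeastI[of ?Q k] Least_le[of ?Q k] assms by (auto simp: p_def)
  moreover have "g s \<le> g x" if "s < x" "x < p" for x
    using not_less_Least[of x ?Q] that by (auto simp: p_def)
  ultimately have "p \<in> targets k g s" by (auto simp: targets_def)
  then show ?thesis by blast
qed

lemma steps_horizontal:
  assumes "i < m" "p \<noteq> i"
  shows "(p, j) \<in> steps m n g h (i, j) \<longleftrightarrow> p \<in> targets m g i \<and> (j < n \<longrightarrow> h j \<le> g i)"
  using assms by (auto simp: steps_def)

lemma steps_vertical:
  assumes "j < n" "q \<noteq> j"
  shows "(i, q) \<in> steps m n g h (i, j) \<longleftrightarrow> q \<in> targets n h j \<and> (i < m \<longrightarrow> g i \<le> h j)"
  using assms by (auto simp: steps_def)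

text \<open>The targets of each direction can be read off where the other direction offers no step:
  at \<open>(s, n)\<close> and at \<open>(m, i)\<close>. At the other vertices the presence of a
  horizontal step says \<open>h i <= g s\<close>, that of a vertical one \<open>g s <= h i\<close>;
  since targets always exist, both comparisons are detected.\<close>

lemma steps_subset_iff:
  assumes "1 \<le> m" "1 \<le> n"
  shows "(\<forall>v \<in> {1..m} \<times> {1..n} - {(m, n)}. steps m n g h v \<subseteq> steps m n g' h' v) \<longleftrightarrow>
    slope_preorder m n g h \<subseteq> slope_preorder m n g' h'"
    (is "?L \<longleftrightarrow> _")
  unfolding slope_preorder_subset_iff
proof (intro iffI conjI ballI)
  assume L: ?L
  then have sub: "steps m n g h (i, j) \<subseteq> steps m n g' h' (i, j)"
    if "1 \<le> i" "i \<le> m" "1 \<le> j" "j \<le> n" "i < m \<or> j < n" for i j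
    using that by auto
  show "targets m g s \<subseteq> targets m g' s" if s: "s \<in> {1..<m}" for s
  proof
    fix p assume p: "p \<in> targets m g s"
    then have "p \<noteq> s" using targets_subset[of m g s] by auto
    then have "(p, n) \<in> steps m n g h (s, n)" using s p steps_horizontal by auto
    then have "(p, n) \<in> steps m n g' h' (s, n)" using sub[of s n] s assms by auto
    then show "p \<in> targets m g' s" using steps_horizontal s \<open>p \<noteq> s\<close> by auto
  qed
  show "targets n h i \<subseteq> targets n h' i" if i: "i \<in> {1..<n}" for i
  proof
    fix q assume q: "q \<in> targets n h i"
    then have "q \<noteq> i" using targets_subset[of n h i] by auto
    then have "(m, q) \<in> steps m n g h (m, i)" using i q steps_vertical by auto
    then have "(m, q) \<in> steps m n g' h' (m, i)" using sub[of m i] i assms by auto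
    then show "q \<in> targets n h' i" using steps_vertical i \<open>q \<noteq> i\<close> by auto
  qed
  fix s i assume s: "s \<in> {1..<m}" and i: "i \<in> {1..<n}"
  then have si: "steps m n g h (s, i) \<subseteq> steps m n g' h' (s, i)" using sub[of s i] by auto
  obtain p where p: "p \<in> targets m g s" using targets_nonempty[of s m g] s by auto
  then have "p \<noteq> s" using targets_subset[of m g s] by auto
  show "h i \<le> g s \<longrightarrow> h' i \<le> g' s"
  proof
    assume "h i \<le> g s"
    then have "(p, i) \<in> steps m n g h (s, i)" using steps_horizontal s p \<open>p \<noteq> s\<close> by simp
    then have "(p, i) \<in> steps m n g' h' (s, i)" using si by blast
    then show "h' i \<le> g' s" using steps_horizontal[of s m p i n g' h'] s i \<open>p \<noteq> s\<close> by simp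
  qed
  obtain q where q: "q \<in> targets n h i" using targets_nonempty[of i n h] i by auto
  then have "q \<noteq> i" using targets_subset[of n h i] by auto
  show "g s \<le> h i \<longrightarrow> g' s \<le> h' i"
  proof
    assume "g s \<le> h i"
    then have "(s, q) \<in> steps m n g h (s, i)" using steps_vertical i q \<open>q \<noteq> i\<close> by simp
    then have "(s, q) \<in> steps m n g' h' (s, i)" using si by blast
    then show "g' s \<le> h' i" using steps_vertical[of i n q s m g' h'] s i \<open>q \<noteq> i\<close> by simp
  qed
next
  fix v
  assume R: "(\<forall>s\<in>{1..<m}. targets m g s \<subseteq> targets m g' s) \<and>
    (\<forall>i\<in>{1..<n}. targets n h i \<subseteq> targets n h' i) \<and>
    (\<forall>s\<in>{1..<m}. \<forall>i\<in>{1..<n}. (h i \<le> g s \<longrightarrow> h' i \<le> g' s) \<and> (g s \<le> h i \<longrightarrow> g' s \<le> h' i))"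
    and "v \<in> {1..m} \<times> {1..n} - {(m, n)}"
  then obtain i j where v: "v = (i, j)" "1 \<le> i" "1 \<le> j" by auto
  show "steps m n g h v \<subseteq> steps m n g' h' v"
  proof
    fix x assume "x \<in> steps m n g h v"
    then consider p where "x = (p, j)" "i < m" "p \<in> targets m g i" "j < n \<longrightarrow> h j \<le> g i"
      | q where "x = (i, q)" "j < n" "q \<in> targets n h j" "i < m \<longrightarrow> g i \<le> h j"
      unfolding steps_def v(1) by blast
    then show "x \<in> steps m n g' h' v"
    proof cases
      case 1
      then have "p \<in> targets m g' i" "j < n \<longrightarrow> h' j \<le> g' i" using R v(2,3) by auto
      then show ?thesis unfolding steps_def v(1) using 1 by blast
    next
      case 2
      then have "q \<in> targets n h' j" "i < m \<longrightarrow> g' i \<le> h' j" using R v(2,3) by auto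
      then show ?thesis unfolding steps_def v(1) using 2 by blast
    qed
  qed
qed

section \<open>Faces of max-slope pivot rule polytopes\<close>

definition maximizers :: "'a::euclidean_space set \<Rightarrow> 'a \<Rightarrow> 'a set" where
  "maximizers S w = {x \<in> S. \<forall>y\<in>S. w \<bullet> y \<le> w \<bullet> x}"

lemma maximizers_convex_hull_iff:
  assumes "x \<in> S"
  shows "x \<in> maximizers (convex hull S) w \<longleftrightarrow> x \<in> maximizers S w"
proof
  assume "x \<in> maximizers S w"
  then have "S \<subseteq> {y. w \<bullet> y \<le> w \<bullet> x}" by (auto simp: maximizers_def)
  then have "convex hull S \<subseteq> {y. w \<bullet> y \<le> w \<bullet> x}"
    by (rule hull_minimal) (rule convex_halfspace_le)
  then show "x \<in> maximizers (convex hull S) w"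
    using assms by (auto simp: maximizers_def hull_inc)
qed (use assms in \<open>auto simp: maximizers_def hull_inc\<close>)

lemma maximizers_eq:
  assumes x: "x \<in> S" and le: "\<And>y. y \<in> S \<Longrightarrow> w \<bullet> y \<le> w \<bullet> x"
  shows "maximizers S w = S \<inter> {y. w \<bullet> y = w \<bullet> x}"
proof (intro set_eqI iffI)
  fix y assume "y \<in> maximizers S w"
  then have "y \<in> S" "w \<bullet> x \<le> w \<bullet> y" using x by (simp_all add: maximizers_def)
  then show "y \<in> S \<inter> {y. w \<bullet> y = w \<bullet> x}" using le[of y] by simp
next
  fix y assume "y \<in> S \<inter> {y. w \<bullet> y = w \<bullet> x}"
  then show "y \<in> maximizers S w" using le by (simp add: maximizers_def)
qed

lemma maximizers_face_of:
  assumes "convex S"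
  shows "maximizers S w face_of S"
proof (cases "maximizers S w = {}")
  case False
  then obtain x where x: "x \<in> S" "\<And>y. y \<in> S \<Longrightarrow> w \<bullet> y \<le> w \<bullet> x"
    by (auto simp: maximizers_def)
  then have "maximizers S w = S \<inter> {y. w \<bullet> y = w \<bullet> x}"
    by (rule maximizers_eq)
  then show ?thesis
    using face_of_Int_supporting_hyperplane_le[OF assms, of w "w \<bullet> x"] x by simp
qed simp

text \<open>Every face of a polytope is exposed, hence cut out by some direction; conversely each
  direction attains its maximum at one of the finitely many generators.\<close>

lemma nonempty_faces_convex_hull:
  assumes "finite S" "S \<noteq> {}"
  shows "nonempty_faces (convex hull S) = range (maximizers (convex hull S))"
proof (intro equalityI subsetI)
  fix F assume "F \<in> nonempty_faces (convex hull S)"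
  then have F: "F face_of convex hull S" "F \<noteq> {}" by (auto simp: nonempty_faces_def)
  have "polyhedron (convex hull S)"
    using assms by (simp add: polytope_convex_hull polytope_imp_polyhedron)
  then have "F exposed_face_of convex hull S"
    using F exposed_face_of_polyhedron by blast
  then obtain w b where "convex hull S \<subseteq> {x. w \<bullet> x \<le> b}" "F = convex hull S \<inter> {x. w \<bullet> x = b}"
    by (auto simp: exposed_face_of_def)
  then have b: "\<And>x. x \<in> convex hull S \<Longrightarrow> w \<bullet> x \<le> b" "F = convex hull S \<inter> {x. w \<bullet> x = b}"
    by blast+
  then obtain x where "x \<in> convex hull S" "w \<bullet> x = b" using F(2) by blast
  then have "F = maximizers (convex hull S) w"
    using maximizers_eq[of x "convex hull S" w] b by simp
  then show "F \<in> range (maximizers (convex hull S))" by blast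
next
  fix F assume "F \<in> range (maximizers (convex hull S))"
  then obtain w where F: "F = maximizers (convex hull S) w" by blast
  have "Max ((\<bullet>) w ` S) \<in> (\<bullet>) w ` S" using assms by (intro Max_in) auto
  then obtain x where "x \<in> S" "w \<bullet> x = Max ((\<bullet>) w ` S)" by force
  then have "x \<in> maximizers S w" using assms by (auto simp: maximizers_def)
  then have "x \<in> F" using \<open>x \<in> S\<close> F maximizers_convex_hull_iff by blast
  then show "F \<in> nonempty_faces (convex hull S)"
    using F maximizers_face_of[OF convex_convex_hull] by (auto simp: nonempty_faces_def)
qed

text \<open>A face of the hull is the hull of some of the generators, so it suffices to compare the
  maximizing generators.\<close>

lemma maximizers_convex_hull_subset_iff:
  assumes "finite S"
  shows "maximizers (convex hull S) w \<subseteq> maximizers (convex hull S) w' \<longleftrightarrow>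
    maximizers S w \<subseteq> maximizers S w'"
proof
  assume sub: "maximizers (convex hull S) w \<subseteq> maximizers (convex hull S) w'"
  show "maximizers S w \<subseteq> maximizers S w'"
  proof
    fix x assume x: "x \<in> maximizers S w"
    then have "x \<in> S" by (simp add: maximizers_def)
    then show "x \<in> maximizers S w'"
      using x sub maximizers_convex_hull_iff[of x S] by blast
  qed
next
  assume sub: "maximizers S w \<subseteq> maximizers S w'"
  obtain S' where S': "S' \<subseteq> S" "maximizers (convex hull S) w = convex hull S'"
    using face_of_convex_hull_subset[OF finite_imp_compact[OF assms]]
      maximizers_face_of[OF convex_convex_hull] by metis
  then have "S' \<subseteq> maximizers S w"
    using maximizers_convex_hull_iff[of _ S w] hull_subset[of S' convex] by blast
  then have "S' \<subseteq> maximizers (convex hull S) w'"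
    using sub S'(1) maximizers_convex_hull_iff[of _ S w'] by blast
  moreover have "convex (maximizers (convex hull S) w')"
    using maximizers_face_of[OF convex_convex_hull] face_of_imp_convex by blast
  ultimately show "maximizers (convex hull S) w \<subseteq> maximizers (convex hull S) w'"
    by (simp add: S'(2) hull_minimal)
qed

section \<open>Maximal slopes vertex by vertex\<close>

definition improving :: "'a::euclidean_space set \<Rightarrow> 'a \<Rightarrow> 'a \<Rightarrow> 'a set" where
  "improving P c v = {u. adjacent P v u \<and> c \<bullet> v < c \<bullet> u}"

definition slope :: "'a::euclidean_space \<Rightarrow> 'a \<Rightarrow> 'a \<Rightarrow> 'a \<Rightarrow> real" where
  "slope c w v u = w \<bullet> (u - v) / (c \<bullet> (u - v))"

definition max_slope :: "'a::euclidean_space set \<Rightarrow> 'a \<Rightarrow> 'a \<Rightarrow> 'a \<Rightarrow> 'a set" where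
  "max_slope P c w v =
     {u \<in> improving P c v. \<forall>u'\<in>improving P c v. slope c w v u' \<le> slope c w v u}"

text \<open>Shows that the choices at different vertices are independent, so that a sum over the
  vertices can be maximized term by term.\<close>

lemma arborescences_eq_PiE:
  "arborescences P c = (\<Pi>\<^sub>E v \<in> vertices P - {opt_vertex P c}. improving P c v)"
proof -
  have "u \<in> vertices P" if "adjacent P v u" for v u using that by (simp add: adjacent_def)
  then show ?thesis
    unfolding arborescences_def improving_def set_eq_iff PiE_iff mem_Collect_eq by blast
qed

lemma inner_arborescence_point:
  "w \<bullet> arborescence_point P c A =
     (\<Sum>v \<in> vertices P - {opt_vertex P c}. slope c w v (A v))"
  by (simp add: arborescence_point_def slope_def inner_sum_right divide_inverse mult.commute)

text \<open>The objective is a sum of one slope per vertex. If the sum is maximal, then exchanging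
  the choice at a single vertex cannot increase it, so each summand is maximal; the converse is
  termwise.\<close>

lemma arborescence_point_in_maximizers_iff:
  assumes fin: "finite (vertices P)" and A: "A \<in> arborescences P c"
  shows "arborescence_point P c A \<in> maximizers (arborescence_point P c ` arborescences P c) w \<longleftrightarrow>
    (\<forall>v \<in> vertices P - {opt_vertex P c}. A v \<in> max_slope P c w v)"
    (is "?L \<longleftrightarrow> ?R")
proof
  let ?V = "vertices P - {opt_vertex P c}"
  assume ?L
  then have opt: "(\<Sum>v\<in>?V. slope c w v (B v)) \<le> (\<Sum>v\<in>?V. slope c w v (A v))"
    if "B \<in> arborescences P c" for B
    using that unfolding maximizers_def inner_arborescence_point[symmetric] by blast
  show ?R
  proof
    fix v assume v: "v \<in> ?V"
    have "slope c w v u \<le> slope c w v (A v)" if "u \<in> improving P c v" for u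
    proof -
      have "A(v := u) \<in> arborescences P c"
        using A v that unfolding arborescences_eq_PiE by (simp add: PiE_iff extensional_def)
      then have "(\<Sum>x\<in>?V. slope c w x ((A(v := u)) x)) \<le> (\<Sum>x\<in>?V. slope c w x (A x))"
        by (rule opt)
      moreover have "(\<Sum>x\<in>?V - {v}. slope c w x ((A(v := u)) x)) = (\<Sum>x\<in>?V - {v}. slope c w x (A x))"
        by (rule sum.cong) auto
      moreover have split: "(\<Sum>x\<in>?V. g x) = g v + (\<Sum>x\<in>?V - {v}. g x)" for g :: "_ \<Rightarrow> real"
        using fin v by (intro sum.remove) auto
      ultimately have "slope c w v ((A(v := u)) v) \<le> slope c w v (A v)"
        using split[of "\<lambda>x. slope c w x ((A(v := u)) x)"] split[of "\<lambda>x. slope c w x (A x)"]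
        by linarith
      then show ?thesis by simp
    qed
    then show "A v \<in> max_slope P c w v"
      using A v unfolding arborescences_eq_PiE max_slope_def by blast
  qed
next
  assume R: ?R
  have "w \<bullet> arborescence_point P c B \<le> w \<bullet> arborescence_point P c A"
    if "B \<in> arborescences P c" for B
    unfolding inner_arborescence_point
  proof (rule sum_mono)
    fix v assume v: "v \<in> vertices P - {opt_vertex P c}"
    then have "B v \<in> improving P c v"
      using that unfolding arborescences_eq_PiE by blast
    then show "slope c w v (B v) \<le> slope c w v (A v)"
      using R v unfolding max_slope_def by blast
  qed
  then show ?L using A unfolding maximizers_def by blast
qed

lemma max_slope_nonempty:
  assumes "finite (vertices P)" "improving P c v \<noteq> {}"
  shows "max_slope P c w v \<noteq> {}"
proof -
  have "finite (improving P c v)"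
    by (rule finite_subset[OF _ assms(1)]) (auto simp: improving_def adjacent_def)
  then have "Max (slope c w v ` improving P c v) \<in> slope c w v ` improving P c v"
    using assms by (intro Max_in) auto
  then obtain u where "u \<in> improving P c v" "slope c w v u = Max (slope c w v ` improving P c v)"
    by force
  then have "u \<in> max_slope P c w v"
    using \<open>finite (improving P c v)\<close> by (simp add: max_slope_def)
  then show ?thesis by blast
qed

lemma maximizers_arborescence_points_subset_iff:
  assumes fin: "finite (vertices P)"
    and ne: "\<And>v. v \<in> vertices P - {opt_vertex P c} \<Longrightarrow> improving P c v \<noteq> {}"
  defines "S \<equiv> arborescence_point P c ` arborescences P c"
  shows "maximizers S w \<subseteq> maximizers S w' \<longleftrightarrow>
    (\<forall>v \<in> vertices P - {opt_vertex P c}. max_slope P c w v \<subseteq> max_slope P c w' v)"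
proof
  let ?V = "vertices P - {opt_vertex P c}"
  assume sub: "maximizers S w \<subseteq> maximizers S w'"
  show "\<forall>v\<in>?V. max_slope P c w v \<subseteq> max_slope P c w' v"
  proof (intro ballI subsetI)
    fix v u assume v: "v \<in> ?V" and u: "u \<in> max_slope P c w v"
    \<comment> \<open>The choice \<open>u\<close> at \<open>v\<close> is completed by choices of
      maximal slope at all other vertices.\<close>
    define B where "B x = (if x = v then u else SOME y. y \<in> max_slope P c w x)" for x
    have B: "B x \<in> max_slope P c w x" if "x \<in> ?V" for x
      using u max_slope_nonempty[OF fin ne[OF that], of w] by (auto simp: B_def some_in_eq)
    let ?A = "restrict B ?V"
    have A: "?A \<in> arborescences P c"
      using B unfolding arborescences_eq_PiE by (auto simp: max_slope_def)
    then have "arborescence_point P c ?A \<in> maximizers S w"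
      unfolding S_def using B arborescence_point_in_maximizers_iff[OF fin A] by auto
    then have "arborescence_point P c ?A \<in> maximizers S w'" using sub by blast
    then have "?A v \<in> max_slope P c w' v"
      unfolding S_def using v arborescence_point_in_maximizers_iff[OF fin A] by blast
    then show "u \<in> max_slope P c w' v" using v by (simp add: B_def)
  qed
next
  assume sub: "\<forall>v \<in> vertices P - {opt_vertex P c}. max_slope P c w v \<subseteq> max_slope P c w' v"
  show "maximizers S w \<subseteq> maximizers S w'"
  proof
    fix x assume x: "x \<in> maximizers S w"
    then obtain A where A: "A \<in> arborescences P c" "x = arborescence_point P c A"
      by (auto simp: maximizers_def S_def)
    then show "x \<in> maximizers S w'"
      using x sub unfolding S_def A(2) arborescence_point_in_maximizers_iff[OF fin A(1)] by blast
  qed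
qed

text \<open>Mutual inclusion gives \<open>F x = F y\<close> exactly if \<open>G x = G y\<close>, so
  sending \<open>F x\<close> to \<open>G x\<close> is well defined and injective.\<close>

lemma inclusion_isomorphic_range:
  assumes "\<And>x y. F x \<subseteq> F y \<longleftrightarrow> G x \<subseteq> G y"
  shows "inclusion_isomorphic (range F) (range G)"
proof -
  have eq: "F x = F y \<longleftrightarrow> G x = G y" for x y
    using assms[of x y] assms[of y x] by auto
  define \<phi> where "\<phi> A = G (SOME x. F x = A)" for A
  have \<phi>: "\<phi> (F x) = G x" for x
    using someI[of "\<lambda>y. F y = F x" x] eq by (auto simp: \<phi>_def)
  have "bij_betw \<phi> (range F) (range G)"
    by (auto simp: bij_betw_def inj_on_def \<phi> eq image_image)
  then show ?thesis
    unfolding inclusion_isomorphic_def using assms by (intro exI[of _ \<phi>]) (auto simp: \<phi>)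
qed

lemma inclusion_isomorphic_pivot_rule_polytope:
  assumes fin: "finite (vertices P)"
    and ne: "\<And>v. v \<in> vertices P - {opt_vertex P c} \<Longrightarrow> improving P c v \<noteq> {}"
    and G: "\<And>w w'. (\<forall>v \<in> vertices P - {opt_vertex P c}. max_slope P c w v \<subseteq> max_slope P c w' v) \<longleftrightarrow>
      G w \<subseteq> G w'"
  shows "inclusion_isomorphic (nonempty_faces (pivot_rule_polytope P c)) (range G)"
proof -
  let ?S = "arborescence_point P c ` arborescences P c"
  have "finite (improving P c v)" for v
    by (rule finite_subset[OF _ fin]) (auto simp: improving_def adjacent_def)
  then have "finite (arborescences P c)"
    unfolding arborescences_eq_PiE using fin by (intro finite_PiE) auto
  then have S: "finite ?S" by (rule finite_imageI)
  have "arborescences P c \<noteq> {}"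
    unfolding arborescences_eq_PiE PiE_eq_empty_iff using ne by blast
  then have S': "?S \<noteq> {}" by simp
  have "maximizers (convex hull ?S) w \<subseteq> maximizers (convex hull ?S) w' \<longleftrightarrow> G w \<subseteq> G w'" for w w'
    unfolding maximizers_convex_hull_subset_iff[OF S]
    by (rule trans[OF maximizers_arborescence_points_subset_iff[OF fin ne] G])
  then show ?thesis
    unfolding pivot_rule_polytope_def nonempty_faces_convex_hull[OF S S']
    by (rule inclusion_isomorphic_range)
qed

section \<open>Products of two simplices\<close>

lemma standard_simplex_eq: "standard_simplex = convex hull (Basis :: (real ^ 'k) set)"
proof -
  have "range (\<lambda>i. axis i 1) = (Basis :: (real ^ 'k) set)" by (auto simp: Basis_vec_def)
  then show ?thesis by (simp add: standard_simplex_def)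
qed

lemma affine_independent_Basis: "\<not> affine_dependent (Basis :: 'a::euclidean_space set)"
  using affine_dependent_imp_dependent independent_Basis by blast

lemma axis_in_Basis: "axis i (1::real) \<in> Basis"
  by (auto simp: Basis_vec_def)

lemma axis_in_standard_simplex: "axis i 1 \<in> standard_simplex"
  by (simp add: standard_simplex_eq axis_in_Basis hull_inc)

text \<open>Extreme points are singleton faces, and a product of two singletons is a face exactly if
  both factors are.\<close>

lemma vertices_simplex_product:
  "vertices (standard_simplex \<times> standard_simplex :: ((real ^ 'm) \<times> (real ^ 'n)) set) =
     range (\<lambda>(i, j). (axis i 1, axis j 1))"
proof -
  have "(x, y) \<in> vertices (standard_simplex \<times> standard_simplex) \<longleftrightarrow> x \<in> Basis \<and> y \<in> Basis"
    for x :: "real ^ 'm" and y :: "real ^ 'n"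
  proof -
    have "{(x, y)} = {x} \<times> {y}" by auto
    then have "(x, y) extreme_point_of (standard_simplex \<times> standard_simplex) \<longleftrightarrow>
        x extreme_point_of standard_simplex \<and> y extreme_point_of standard_simplex"
      by (metis face_of_singleton face_of_Times_eq insert_not_empty)
    then show ?thesis
      by (simp add: vertices_def standard_simplex_eq affine_independent_Basis
          extreme_point_of_convex_hull_affine_independent)
  qed
  then show ?thesis by (force simp: Basis_vec_def image_iff)
qed

text \<open>Any set of vertices of a simplex spans a face.\<close>

lemma edge_of_standard_simplex:
  assumes "i \<noteq> k"
  shows "closed_segment (axis i 1) (axis k 1) edge_of (standard_simplex :: (real ^ 'k) set)"
proof -
  have "closed_segment (axis i 1) (axis k 1) face_of (standard_simplex :: (real ^ 'k) set)"
    using face_of_convex_hull_affine_independent[OF affine_independent_Basis, of "closed_segment (axis i 1) (axis k 1)"]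
    by (auto simp: standard_simplex_eq segment_convex_hull axis_in_Basis intro!: exI[of _ "{axis i 1, axis k 1}"])
  moreover have "aff_dim (closed_segment (axis i 1) (axis k (1::real))) = 1"
    using assms by (simp add: segment_convex_hull aff_dim_convex_hull aff_dim_2 axis_eq_axis)
  ultimately show ?thesis by (simp add: edge_of_def)
qed

lemma closed_segment_Times_singleton:
  fixes a b :: "'a::euclidean_space" and z :: "'b::euclidean_space"
  shows "closed_segment (a, z) (b, z) = closed_segment a b \<times> {z}"
    and "closed_segment (z, a) (z, b) = {z} \<times> closed_segment a b"
  by (auto simp: in_segment scaleR_left_distrib[symmetric])

lemma closed_segment_Times_edge_of:
  fixes a b :: "'a::euclidean_space" and z :: "'b::euclidean_space"
  assumes "closed_segment a b edge_of S" "z extreme_point_of T"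
  shows "closed_segment (a, z) (b, z) edge_of S \<times> T"
    and "closed_segment (z, a) (z, b) edge_of T \<times> S"
proof -
  have ab: "a \<noteq> b" using assms(1) by (auto simp: edge_of_def)
  have "closed_segment a b face_of S" "{z} face_of T"
    using assms by (simp_all add: edge_of_def face_of_singleton)
  then have "closed_segment a b \<times> {z} face_of S \<times> T" "{z} \<times> closed_segment a b face_of T \<times> S"
    by (simp_all add: face_of_Times)
  then show "closed_segment (a, z) (b, z) edge_of S \<times> T"
    "closed_segment (z, a) (z, b) edge_of T \<times> S"
    unfolding closed_segment_Times_singleton[symmetric] edge_of_def
    using ab by (simp_all add: segment_convex_hull aff_dim_convex_hull aff_dim_2)
qed

text \<open>A diagonal of a square is no face, since the other diagonal has the same midpoint.\<close>

lemma diagonal_not_face_of: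
  fixes a a' :: "'a::euclidean_space" and b b' :: "'b::euclidean_space"
  assumes "a \<in> S" "a' \<in> S" "b \<in> T" "b' \<in> T" "a \<noteq> a'" "b \<noteq> b'"
  shows "\<not> closed_segment (a, b) (a', b') face_of S \<times> T"
proof
  let ?F = "closed_segment (a, b) (a', b')"
  assume F: "?F face_of S \<times> T"
  have "midpoint (a', b) (a, b') = midpoint (a, b) (a', b')"
    by (simp add: midpoint_def add.commute)
  then have "midpoint (a', b) (a, b') \<in> ?F" by simp
  moreover have "midpoint (a', b) (a, b') \<in> open_segment (a', b) (a, b')"
    using assms by simp
  ultimately have "(a', b) \<in> ?F" using F assms unfolding face_of_def by blast
  then obtain u where u: "a' = (1 - u) *\<^sub>R a + u *\<^sub>R a'" "b = (1 - u) *\<^sub>R b + u *\<^sub>R b'"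
    by (auto simp: in_segment)
  \<comment> \<open>The first component forces \<open>u = 1\<close>, the second
    \<open>u = 0\<close>.\<close>
  have "(1 - u) *\<^sub>R (a' - a) = 0" using u(1) by (simp add: algebra_simps)
  moreover have "u *\<^sub>R (b' - b) = 0"
    using arg_cong[OF u(2), of "\<lambda>z. z - b"] by (simp add: scaleR_left_diff_distrib scaleR_right_diff_distrib)
  ultimately show False using assms by simp
qed

text \<open>Vertices that differ in both components span a diagonal of a square; those that differ
  in one span an edge of one simplex times a vertex of the other.\<close>

lemma adjacent_simplex_product_iff:
  "adjacent (standard_simplex \<times> standard_simplex) (axis i 1, axis j 1) u \<longleftrightarrow>
     (\<exists>k. k \<noteq> i \<and> u = (axis k 1, axis j 1)) \<or> (\<exists>k. k \<noteq> j \<and> u = (axis i 1, axis k 1))"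
  for u :: "(real ^ 'm) \<times> (real ^ 'n)"
proof
  let ?P = "standard_simplex \<times> standard_simplex :: ((real ^ 'm) \<times> (real ^ 'n)) set"
  assume adj: "adjacent ?P (axis i 1, axis j 1) u"
  then obtain k l where u: "u = (axis k 1, axis l 1)"
    unfolding adjacent_def vertices_simplex_product by auto
  have edge: "closed_segment (axis i 1, axis j 1) u edge_of ?P"
    using adj by (simp add: adjacent_def)
  then have "(axis i 1, axis j 1) \<noteq> u" by (auto simp: edge_of_def)
  moreover have "k = i \<or> l = j"
  proof (rule ccontr)
    assume "\<not> (k = i \<or> l = j)"
    then have "\<not> closed_segment (axis i 1, axis j 1) u face_of ?P"
      unfolding u by (intro diagonal_not_face_of) (auto simp: axis_in_standard_simplex axis_eq_axis)
    then show False using edge by (simp add: edge_of_def)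
  qed
  ultimately show "(\<exists>k. k \<noteq> i \<and> u = (axis k 1, axis j 1)) \<or> (\<exists>k. k \<noteq> j \<and> u = (axis i 1, axis k 1))"
    by (auto simp: u)
next
  have ext: "axis k 1 extreme_point_of (standard_simplex :: (real ^ 'k) set)" for k :: "'k::finite"
    by (simp add: standard_simplex_eq affine_independent_Basis axis_in_Basis
        extreme_point_of_convex_hull_affine_independent)
  assume "(\<exists>k. k \<noteq> i \<and> u = (axis k 1, axis j 1)) \<or> (\<exists>k. k \<noteq> j \<and> u = (axis i 1, axis k 1))"
  then show "adjacent (standard_simplex \<times> standard_simplex) (axis i 1, axis j 1) u"
    unfolding adjacent_def vertices_simplex_product
    by (auto intro!: closed_segment_Times_edge_of edge_of_standard_simplex ext)
qed

text \<open>The enumeration is the inverse of the rank, the number of values not exceeding a given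
  one.\<close>

lemma sorted_enumeration:
  fixes a :: "'k::finite \<Rightarrow> real"
  assumes "inj a"
  obtains e where "bij_betw e {1..CARD('k)} UNIV" "strict_mono_on {1..CARD('k)} (a \<circ> e)"
proof -
  define rank where "rank i = card {k. a k \<le> a i}" for i
  have less: "rank i < rank k" if "a i < a k" for i k
  proof -
    have "{x. a x \<le> a i} \<subseteq> {x. a x \<le> a k}" using that by auto
    moreover have "k \<in> {x. a x \<le> a k}" "k \<notin> {x. a x \<le> a i}" using that by auto
    ultimately have "{x. a x \<le> a i} \<subset> {x. a x \<le> a k}" by blast
    then show ?thesis unfolding rank_def by (intro psubset_card_mono) auto
  qed
  have "inj rank"
    using assms less by (metis injI inj_eq linorder_neqE less_irrefl)
  moreover have "rank i \<in> {1..CARD('k)}" for i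
  proof -
    have "card {i} \<le> rank i" "rank i \<le> CARD('k)"
      unfolding rank_def by (rule card_mono; simp)+
    then show ?thesis by simp
  qed
  then have "range rank \<subseteq> {1..CARD('k)}" by blast
  ultimately have rank: "bij_betw rank UNIV {1..CARD('k)}"
    by (simp add: bij_betw_def card_image card_subset_eq)
  define e where "e = inv_into UNIV rank"
  have e: "bij_betw e {1..CARD('k)} UNIV"
    unfolding e_def by (rule bij_betw_inv_into[OF rank])
  have rank_e: "rank (e r) = r" if "r \<in> {1..CARD('k)}" for r
    unfolding e_def by (rule bij_betw_inv_into_right[OF rank that])
  have "strict_mono_on {1..CARD('k)} (a \<circ> e)"
  proof (rule strict_mono_onI)
    fix r s assume r: "r \<in> {1..CARD('k)}" and s: "s \<in> {1..CARD('k)}" and "r < s"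
    then have "rank (e r) < rank (e s)" by (simp only: rank_e)
    then have "\<not> a (e s) \<le> a (e r)"
      using less[of "e s" "e r"] assms by (metis inj_eq less_asym less_irrefl order_le_less)
    then show "(a \<circ> e) r < (a \<circ> e) s" by simp
  qed
  with e show ?thesis by (rule that)
qed

section \<open>The product of simplices with its vertices sorted by \<open>c\<close>\<close>

locale sorted_simplex_product =
  fixes c :: "(real ^ 'm) \<times> (real ^ 'n)" and m n :: nat and e :: "nat \<Rightarrow> 'm" and f :: "nat \<Rightarrow> 'n"
  assumes m_eq: "m = CARD('m)" and n_eq: "n = CARD('n)"
    and e_bij: "bij_betw e {1..m} UNIV" and f_bij: "bij_betw f {1..n} UNIV"
    and e_mono: "strict_mono_on {1..m} (\<lambda>r. fst c $ e r)"
    and f_mono: "strict_mono_on {1..n} (\<lambda>r. snd c $ f r)"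
begin

abbreviation "P \<equiv> standard_simplex \<times> standard_simplex :: ((real ^ 'm) \<times> (real ^ 'n)) set"
abbreviation "grid \<equiv> {1..m} \<times> {1..n}"

lemma one_le: "1 \<le> m" "1 \<le> n"
  by (simp_all add: m_eq n_eq Suc_le_eq card_gt_0_iff)

definition vtx :: "nat \<times> nat \<Rightarrow> (real ^ 'm) \<times> (real ^ 'n)" where
  "vtx = (\<lambda>(i, j). (axis (e i) 1, axis (f j) 1))"

lemma e_less_iff: "i \<in> {1..m} \<Longrightarrow> k \<in> {1..m} \<Longrightarrow> fst c $ e i < fst c $ e k \<longleftrightarrow> i < k"
  using strict_mono_on_less[OF e_mono] .

lemma f_less_iff: "j \<in> {1..n} \<Longrightarrow> k \<in> {1..n} \<Longrightarrow> snd c $ f j < snd c $ f k \<longleftrightarrow> j < k"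
  using strict_mono_on_less[OF f_mono] .

lemma ex_e: "\<exists>k\<in>{1..m}. i = e k"
  using e_bij unfolding bij_betw_def by blast

lemma ex_f: "\<exists>k\<in>{1..n}. j = f k"
  using f_bij unfolding bij_betw_def by blast

lemma inj_on_vtx: "inj_on vtx grid"
proof (rule inj_onI)
  fix x y assume "x \<in> grid" "y \<in> grid" "vtx x = vtx y"
  then have "fst x \<in> {1..m}" "fst y \<in> {1..m}" "e (fst x) = e (fst y)"
    "snd x \<in> {1..n}" "snd y \<in> {1..n}" "f (snd x) = f (snd y)"
    by (auto simp: vtx_def case_prod_beta axis_eq_axis)
  then have "fst x = fst y" "snd x = snd y"
    using bij_betw_imp_inj_on[OF e_bij] bij_betw_imp_inj_on[OF f_bij] by (blast dest: inj_onD)+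
  then show "x = y" by (rule prod_eqI)
qed

lemma vertices_eq: "vertices P = vtx ` grid"
proof -
  have "(axis i 1, axis j 1) \<in> vtx ` grid" for i j
  proof -
    obtain k l where "k \<in> {1..m}" "l \<in> {1..n}" "i = e k" "j = f l" using ex_e ex_f by blast
    then show ?thesis by (intro image_eqI[of _ _ "(k, l)"]) (simp_all add: vtx_def)
  qed
  then show ?thesis unfolding vertices_simplex_product by (auto simp: vtx_def)
qed

lemma inner_vtx: "w \<bullet> vtx (i, j) = fst w $ e i + snd w $ f j"
  by (simp add: vtx_def inner_prod_def inner_axis)

lemma opt_vertex_eq: "opt_vertex P c = vtx (m, n)"
  unfolding opt_vertex_def
proof (rule the_equality)
  have "fst c \<bullet> x \<le> fst c $ e m" if "x \<in> standard_simplex" for x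
  proof -
    have "fst c $ i \<le> fst c $ e m" for i
    proof -
      obtain k where "k \<in> {1..m}" "i = e k" using ex_e by blast
      then show ?thesis using e_less_iff[of m k] by (auto simp: not_less[symmetric])
    qed
    then have "range (\<lambda>i. axis i 1) \<subseteq> {x. fst c \<bullet> x \<le> fst c $ e m}" by (auto simp: inner_axis)
    then have "standard_simplex \<subseteq> {x. fst c \<bullet> x \<le> fst c $ e m}"
      unfolding standard_simplex_def by (rule hull_minimal) (rule convex_halfspace_le)
    then show ?thesis using that by blast
  qed
  moreover have "snd c \<bullet> y \<le> snd c $ f n" if "y \<in> standard_simplex" for y
  proof -
    have "snd c $ i \<le> snd c $ f n" for i
    proof -
      obtain k where "k \<in> {1..n}" "i = f k" using ex_f by blast
      then show ?thesis using f_less_iff[of n k] by (auto simp: not_less[symmetric])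
    qed
    then have "range (\<lambda>i. axis i 1) \<subseteq> {y. snd c \<bullet> y \<le> snd c $ f n}" by (auto simp: inner_axis)
    then have "standard_simplex \<subseteq> {y. snd c \<bullet> y \<le> snd c $ f n}"
      unfolding standard_simplex_def by (rule hull_minimal) (rule convex_halfspace_le)
    then show ?thesis using that by blast
  qed
  ultimately have "c \<bullet> x \<le> c \<bullet> vtx (m, n)" if "x \<in> P" for x
    using that by (auto simp: vtx_def inner_axis inner_prod_def intro: add_mono)
  moreover have mn: "(m, n) \<in> grid" using one_le by simp
  ultimately show "vtx (m, n) \<in> vertices P \<and> (\<forall>x\<in>P. c \<bullet> x \<le> c \<bullet> vtx (m, n))"
    unfolding vertices_eq by blast
  fix v assume v: "v \<in> vertices P \<and> (\<forall>x\<in>P. c \<bullet> x \<le> c \<bullet> v)"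
  then obtain i j where ij: "i \<in> {1..m}" "j \<in> {1..n}" "v = vtx (i, j)"
    unfolding vertices_eq by auto
  have "vtx (m, n) \<in> P" by (simp add: vtx_def axis_in_standard_simplex)
  then have "fst c $ e m + snd c $ f n \<le> fst c $ e i + snd c $ f j"
    unfolding inner_vtx[symmetric] ij(3)[symmetric] by (rule bspec[OF conjunct2[OF v]])
  moreover have "i < m \<Longrightarrow> fst c $ e i < fst c $ e m" "j < n \<Longrightarrow> snd c $ f j < snd c $ f n"
    using e_less_iff[of i m] f_less_iff[of j n] ij mn by auto
  moreover have "i = m \<or> i < m" "j = n \<or> j < n" using ij by auto
  ultimately have "i = m" "j = n" by force+
  then show "v = vtx (m, n)" using ij by simp
qed

lemma nonopt_vertices_eq: "vertices P - {opt_vertex P c} = vtx ` (grid - {(m, n)})"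
proof -
  have "(m, n) \<in> grid" using one_le by simp
  then have "vtx ` (grid - {(m, n)}) = vtx ` grid - vtx ` {(m, n)}"
    by (intro inj_on_image_set_diff[OF inj_on_vtx]) auto
  then show ?thesis unfolding vertices_eq opt_vertex_eq by simp
qed

lemma improving_vtx:
  assumes i: "i \<in> {1..m}" and j: "j \<in> {1..n}"
  shows "improving P c (vtx (i, j)) = vtx ` ({i<..m} \<times> {j} \<union> {i} \<times> {j<..n})"
proof (intro set_eqI iffI)
  fix u assume "u \<in> improving P c (vtx (i, j))"
  then have adj: "adjacent P (axis (e i) 1, axis (f j) 1) u" and less: "c \<bullet> vtx (i, j) < c \<bullet> u"
    by (auto simp: improving_def vtx_def)
  from adj[unfolded adjacent_simplex_product_iff]
  show "u \<in> vtx ` ({i<..m} \<times> {j} \<union> {i} \<times> {j<..n})"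
  proof
    assume "\<exists>k. k \<noteq> e i \<and> u = (axis k 1, axis (f j) 1)"
    then obtain p where p: "p \<in> {1..m}" "u = vtx (p, j)"
      unfolding vtx_def case_prod_conv using ex_e by metis
    then have "i < p" using less e_less_iff[OF i p(1)] by (simp add: inner_vtx)
    then show ?thesis using p by auto
  next
    assume "\<exists>k. k \<noteq> f j \<and> u = (axis (e i) 1, axis k 1)"
    then obtain p where p: "p \<in> {1..n}" "u = vtx (i, p)"
      unfolding vtx_def case_prod_conv using ex_f by metis
    then have "j < p" using less f_less_iff[OF j p(1)] by (simp add: inner_vtx)
    then show ?thesis using p by auto
  qed
next
  fix u assume "u \<in> vtx ` ({i<..m} \<times> {j} \<union> {i} \<times> {j<..n})"
  then consider p where "p \<in> {i<..m}" "u = vtx (p, j)" | p where "p \<in> {j<..n}" "u = vtx (i, p)"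
    by blast
  then show "u \<in> improving P c (vtx (i, j))"
  proof cases
    case 1
    then have less: "fst c $ e i < fst c $ e p" using e_less_iff[of i p] i by auto
    then have "e p \<noteq> e i" by auto
    then have "adjacent P (vtx (i, j)) u"
      unfolding 1(2) vtx_def case_prod_conv adjacent_simplex_product_iff by blast
    then show ?thesis using less by (simp add: improving_def 1(2) inner_vtx)
  next
    case 2
    then have less: "snd c $ f j < snd c $ f p" using f_less_iff[of j p] j by auto
    then have "f p \<noteq> f j" by auto
    then have "adjacent P (vtx (i, j)) u"
      unfolding 2(2) vtx_def case_prod_conv adjacent_simplex_product_iff by blast
    then show ?thesis using less by (simp add: improving_def 2(2) inner_vtx)
  qed
qed

definition horizontal_slope :: "(real ^ 'm) \<times> (real ^ 'n) \<Rightarrow> nat \<Rightarrow> real" where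
  "horizontal_slope w = steepest m (\<lambda>r. fst c $ e r) (\<lambda>r. fst w $ e r)"

definition vertical_slope :: "(real ^ 'm) \<times> (real ^ 'n) \<Rightarrow> nat \<Rightarrow> real" where
  "vertical_slope w = steepest n (\<lambda>r. snd c $ f r) (\<lambda>r. snd w $ f r)"

text \<open>Only one component changes along such an edge, so the other cancels; what remains are
  planar chords with abscissae from \<open>c\<close> and heights from \<open>w\<close>.\<close>

lemma slope_vtx:
  "slope c w (vtx (i, j)) (vtx (p, j)) = chord (\<lambda>r. fst c $ e r) (\<lambda>r. fst w $ e r) i p"
  "slope c w (vtx (i, j)) (vtx (i, q)) = chord (\<lambda>r. snd c $ f r) (\<lambda>r. snd w $ f r) j q"
  by (simp_all add: slope_def chord_def inner_diff_right inner_vtx)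

text \<open>The best slope out of \<open>(i, j)\<close> is the larger of the steepest horizontal and
  vertical ones. A horizontal neighbor attains it exactly if its chord is steepest and the
  horizontal slope is at least the vertical one, and symmetrically.\<close>

lemma max_slope_vtx:
  assumes i: "i \<in> {1..m}" and j: "j \<in> {1..n}"
  shows "max_slope P c w (vtx (i, j)) =
    vtx ` steps m n (horizontal_slope w) (vertical_slope w) (i, j)"
proof -
  let ?H = "chord (\<lambda>r. fst c $ e r) (\<lambda>r. fst w $ e r) i"
  let ?V = "chord (\<lambda>r. snd c $ f r) (\<lambda>r. snd w $ f r) j"
  let ?h = "horizontal_slope w i" and ?v = "vertical_slope w j"
  \<comment> \<open>For \<open>i = m\<close> there are no horizontal chords and \<open>?h\<close> is
    a maximum over the empty set, hence the guard.\<close>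
  have H_le: "(\<forall>p\<in>{i<..m}. ?H p \<le> z) \<longleftrightarrow> (i < m \<longrightarrow> ?h \<le> z)" for z
    unfolding horizontal_slope_def steepest_def by (cases "i < m") auto
  have V_le: "(\<forall>q\<in>{j<..n}. ?V q \<le> z) \<longleftrightarrow> (j < n \<longrightarrow> ?v \<le> z)" for z
    unfolding vertical_slope_def steepest_def by (cases "j < n") auto
  have best: "u \<in> max_slope P c w (vtx (i, j)) \<longleftrightarrow> u \<in> improving P c (vtx (i, j)) \<and>
      (i < m \<longrightarrow> ?h \<le> slope c w (vtx (i, j)) u) \<and> (j < n \<longrightarrow> ?v \<le> slope c w (vtx (i, j)) u)" for u
  proof -
    have "(\<forall>u'\<in>improving P c (vtx (i, j)). slope c w (vtx (i, j)) u' \<le> z) \<longleftrightarrow>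
        (\<forall>p\<in>{i<..m}. ?H p \<le> z) \<and> (\<forall>q\<in>{j<..n}. ?V q \<le> z)" for z
      unfolding improving_vtx[OF i j] slope_vtx(1)[of w i j, symmetric] slope_vtx(2)[of w i j, symmetric]
      by blast
    then show ?thesis unfolding H_le V_le by (simp add: max_slope_def)
  qed
  have tH: "p \<in> targets m (horizontal_slope w) i \<longleftrightarrow> p \<in> {i<..m} \<and> ?h \<le> ?H p" if "i < m" for p
    unfolding horizontal_slope_def using i that
    by (auto simp: targets_steepest_iff[OF e_mono] dest: chord_le_steepest intro: antisym)
  have tV: "q \<in> targets n (vertical_slope w) j \<longleftrightarrow> q \<in> {j<..n} \<and> ?v \<le> ?V q" if "j < n" for q
    unfolding vertical_slope_def using j that
    by (auto simp: targets_steepest_iff[OF f_mono] dest: chord_le_steepest intro: antisym)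
  have hH: "p \<in> {i<..m} \<Longrightarrow> ?H p \<le> ?h" for p
    by (simp add: chord_le_steepest horizontal_slope_def)
  have vV: "q \<in> {j<..n} \<Longrightarrow> ?V q \<le> ?v" for q
    by (simp add: chord_le_steepest vertical_slope_def)
  have H: "vtx (p, j) \<in> max_slope P c w (vtx (i, j)) \<longleftrightarrow>
      (p, j) \<in> steps m n (horizontal_slope w) (vertical_slope w) (i, j)"
    if p: "p \<in> {i<..m}" for p
  proof -
    have "vtx (p, j) \<in> improving P c (vtx (i, j))" unfolding improving_vtx[OF i j] using p by blast
    then have "vtx (p, j) \<in> max_slope P c w (vtx (i, j)) \<longleftrightarrow> ?h \<le> ?H p \<and> (j < n \<longrightarrow> ?v \<le> ?H p)"
      unfolding best slope_vtx using p by auto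
    also have "\<dots> \<longleftrightarrow> p \<in> targets m (horizontal_slope w) i \<and> (j < n \<longrightarrow> ?v \<le> ?h)"
      using tH[of p] p hH[OF p] by auto
    also have "\<dots> \<longleftrightarrow> (p, j) \<in> steps m n (horizontal_slope w) (vertical_slope w) (i, j)"
      using p by (subst steps_horizontal) auto
    finally show ?thesis .
  qed
  have V: "vtx (i, q) \<in> max_slope P c w (vtx (i, j)) \<longleftrightarrow>
      (i, q) \<in> steps m n (horizontal_slope w) (vertical_slope w) (i, j)"
    if q: "q \<in> {j<..n}" for q
  proof -
    have "vtx (i, q) \<in> improving P c (vtx (i, j))" unfolding improving_vtx[OF i j] using q by blast
    then have "vtx (i, q) \<in> max_slope P c w (vtx (i, j)) \<longleftrightarrow> ?v \<le> ?V q \<and> (i < m \<longrightarrow> ?h \<le> ?V q)"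
      unfolding best slope_vtx using q by auto
    also have "\<dots> \<longleftrightarrow> q \<in> targets n (vertical_slope w) j \<and> (i < m \<longrightarrow> ?h \<le> ?v)"
      using tV[of q] q vV[OF q] by auto
    also have "\<dots> \<longleftrightarrow> (i, q) \<in> steps m n (horizontal_slope w) (vertical_slope w) (i, j)"
      using q by (subst steps_vertical) auto
    finally show ?thesis .
  qed
  let ?N = "{i<..m} \<times> {j} \<union> {i} \<times> {j<..n}"
  have "steps m n (horizontal_slope w) (vertical_slope w) (i, j) \<subseteq> ?N"
    using targets_subset unfolding steps_def by fastforce
  moreover have "max_slope P c w (vtx (i, j)) \<subseteq> vtx ` ?N"
    unfolding max_slope_def improving_vtx[OF i j] by blast
  moreover have "vtx x \<in> max_slope P c w (vtx (i, j)) \<longleftrightarrow>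
      x \<in> steps m n (horizontal_slope w) (vertical_slope w) (i, j)" if "x \<in> ?N" for x
    using that H V by blast
  ultimately show ?thesis by blast
qed

lemma max_slope_subset_iff:
  "(\<forall>v \<in> vertices P - {opt_vertex P c}. max_slope P c w v \<subseteq> max_slope P c w' v) \<longleftrightarrow>
    slope_preorder m n (horizontal_slope w) (vertical_slope w) \<subseteq>
    slope_preorder m n (horizontal_slope w') (vertical_slope w')"
proof -
  have "max_slope P c w (vtx v) \<subseteq> max_slope P c w' (vtx v) \<longleftrightarrow>
      steps m n (horizontal_slope w) (vertical_slope w) v \<subseteq>
      steps m n (horizontal_slope w') (vertical_slope w') v" if grid: "v \<in> grid" for v
  proof -
    obtain i j where v: "v = (i, j)" "i \<in> {1..m}" "j \<in> {1..n}" using grid by (cases v) auto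
    have "steps m n g h (i, j) \<subseteq> grid" for g h
      using v targets_subset[of m g i] targets_subset[of n h j] unfolding steps_def by fastforce
    then show ?thesis
      unfolding v(1) max_slope_vtx[OF v(2,3)] by (intro inj_on_image_subset_iff[OF inj_on_vtx])
  qed
  then show ?thesis
    unfolding nonopt_vertices_eq
    by (subst steps_subset_iff[OF one_le, symmetric]) auto
qed

lemma range_slope_preorder:
  "range (\<lambda>w. slope_preorder m n (horizontal_slope w) (vertical_slope w)) = constrainahedron m n"
proof (intro equalityI subsetI)
  fix R assume "R \<in> constrainahedron m n"
  then obtain g h where R: "R = slope_preorder m n g h"
    unfolding constrainahedron_def using good_rectangular_imp_slope_preorder by blast
  obtain x where x: "\<And>s. 1 \<le> s \<Longrightarrow> s < m \<Longrightarrow> steepest m (\<lambda>r. fst c $ e r) x s = g s"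
    using exists_steepest[OF e_mono] by blast
  obtain y where y: "\<And>s. 1 \<le> s \<Longrightarrow> s < n \<Longrightarrow> steepest n (\<lambda>r. snd c $ f r) y s = h s"
    using exists_steepest[OF f_mono] by blast
  \<comment> \<open>The realizing heights, indexed by sorted position, are moved back to the
    original coordinates.\<close>
  define w :: "(real ^ 'm) \<times> (real ^ 'n)" where
    "w = ((\<chi> i. x (inv_into {1..m} e i)), (\<chi> j. y (inv_into {1..n} f j)))"
  have w: "fst w $ e r = x r" "snd w $ f s = y s" if "r \<in> {1..m}" "s \<in> {1..n}" for r s
    using that bij_betw_inv_into_left[OF e_bij] bij_betw_inv_into_left[OF f_bij]
    by (simp_all add: w_def)
  have "horizontal_slope w s = g s" if "s \<in> {1..<m}" for s
  proof -
    have "steepest m (\<lambda>r. fst c $ e r) (\<lambda>r. fst w $ e r) s = steepest m (\<lambda>r. fst c $ e r) x s"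
      \<comment> \<open>\<open>w\<close> constrains both indices at once; \<open>1\<close> is a
        valid filler for the other one.\<close>
      unfolding steepest_def chord_def using that w(1)[of _ 1] one_le
      by (intro arg_cong[where f = Max] image_cong) auto
    then show ?thesis using x that by (simp add: horizontal_slope_def)
  qed
  moreover have "vertical_slope w s = h s" if "s \<in> {1..<n}" for s
  proof -
    have "steepest n (\<lambda>r. snd c $ f r) (\<lambda>r. snd w $ f r) s = steepest n (\<lambda>r. snd c $ f r) y s"
      unfolding steepest_def chord_def using that w(2)[of 1] one_le
      by (intro arg_cong[where f = Max] image_cong) auto
    then show ?thesis using y that by (simp add: vertical_slope_def)
  qed
  ultimately have "slope_preorder m n (horizontal_slope w) (vertical_slope w) = R"
    unfolding R by (rule slope_preorder_cong)
  then show "R \<in> range (\<lambda>w. slope_preorder m n (horizontal_slope w) (vertical_slope w))" by blast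
qed (auto simp: constrainahedron_def good_rectangular_slope_preorder)

lemma improving_nonempty:
  assumes "v \<in> vertices P - {opt_vertex P c}"
  shows "improving P c v \<noteq> {}"
proof -
  obtain i j where v: "v = vtx (i, j)" "i \<in> {1..m}" "j \<in> {1..n}" "(i, j) \<noteq> (m, n)"
    using assms unfolding nonopt_vertices_eq by blast
  then have "{i<..m} \<times> {j} \<union> {i} \<times> {j<..n} \<noteq> {}" by auto
  then show ?thesis unfolding v(1) improving_vtx[OF v(2,3)] by blast
qed

lemma inclusion_isomorphic_constrainahedron:
  "inclusion_isomorphic (nonempty_faces (pivot_rule_polytope P c)) (constrainahedron m n)"
proof -
  have "finite (vertices P)" unfolding vertices_eq by simp
  from inclusion_isomorphic_pivot_rule_polytope[OF this improving_nonempty max_slope_subset_iff]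
  show ?thesis unfolding range_slope_preorder .
qed

end

text \<open>Two vertices that differ in one component only are adjacent, so genericity separates any
  two coordinates of the same factor.\<close>

lemma edge_generic_simplex_product_inj:
  fixes c :: "(real ^ 'm) \<times> (real ^ 'n)"
  assumes "edge_generic (standard_simplex \<times> standard_simplex) c"
  shows "inj (($) (fst c))" "inj (($) (snd c))"
proof -
  let ?v = "\<lambda>i j. (axis i 1, axis j 1) :: (real ^ 'm) \<times> (real ^ 'n)"
  have inner: "c \<bullet> ?v i j = fst c $ i + snd c $ j" for i j
    by (simp add: inner_prod_def inner_axis)
  show "inj (($) (fst c))"
  proof (rule injI, rule ccontr)
    fix i k assume eq: "fst c $ i = fst c $ k" and "i \<noteq> k"
    obtain j :: 'n where True by blast
    have "adjacent (standard_simplex \<times> standard_simplex) (?v i j) (?v k j)"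
      unfolding adjacent_simplex_product_iff using \<open>i \<noteq> k\<close>[symmetric] by blast
    then have "c \<bullet> ?v i j \<noteq> c \<bullet> ?v k j" using assms unfolding edge_generic_def by blast
    then show False using eq unfolding inner by simp
  qed
  show "inj (($) (snd c))"
  proof (rule injI, rule ccontr)
    fix j k assume eq: "snd c $ j = snd c $ k" and "j \<noteq> k"
    obtain i :: 'm where True by blast
    have "adjacent (standard_simplex \<times> standard_simplex) (?v i j) (?v i k)"
      unfolding adjacent_simplex_product_iff using \<open>j \<noteq> k\<close>[symmetric] by blast
    then have "c \<bullet> ?v i j \<noteq> c \<bullet> ?v i k" using assms unfolding edge_generic_def by blast
    then show False using eq unfolding inner by simp
  qed
qed

theorem theorem5p8:
  fixes c :: "(real ^ 'm) \<times> (real ^ 'n)"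
  assumes "CARD('m) \<ge> 2" and "CARD('n) \<ge> 2"
    and "edge_generic (standard_simplex \<times> standard_simplex) c"
  shows "inclusion_isomorphic
           (nonempty_faces (pivot_rule_polytope (standard_simplex \<times> standard_simplex) c))
           (constrainahedron CARD('m) CARD('n))"
proof -
  obtain e where e: "bij_betw e {1..CARD('m)} UNIV" "strict_mono_on {1..CARD('m)} (($) (fst c) \<circ> e)"
    using sorted_enumeration[OF edge_generic_simplex_product_inj(1)[OF assms(3)]] by blast
  obtain f where f: "bij_betw f {1..CARD('n)} UNIV" "strict_mono_on {1..CARD('n)} (($) (snd c) \<circ> f)"
    using sorted_enumeration[OF edge_generic_simplex_product_inj(2)[OF assms(3)]] by blast
  interpret sorted_simplex_product c "CARD('m)" "CARD('n)" e f
    using e f by unfold_locales (simp_all add: o_def)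
  show ?thesis by (rule inclusion_isomorphic_constrainahedron)
qed

end
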